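(* Let $k\ge1$, $s_1,\dots,s_k>0$ and $B_1,\dots,B_k$ be $2\times2$ matrices with $\|B_i\|_2=1$. (a) Real case: if $B_i\in M_2(\mathbb R)$ and $\mathcal M_{\mathbb R}(\exp(s_kB_k)\cdots\exp(s_1B_1))=s_1+\dots+s_k$, then either (i) there are an orthogonal matrix $U$, a sign $\varepsilon\in\{1,-1\}$ and reals $\lambda_1,\dots,\lambda_k$ such that $UB_iU^{-1}=\operatorname{diag}(\varepsilon,\lambda_i)$ for all $i$; or (ii) there is an orthogonal matrix $U_0$ with $B_1=\dots=B_k=U_0$. (b) Complex case: if $B_i\in M_2(\mathbb C)$ and $\mathcal M_{\mathbb C}(\exp(s_kB_k)\cdots\exp(s_1B_1))=s_1+\dots+s_k$, then there are a unitary $V$, a complex number $u$ with $|u|=1$ and complex numbers $\lambda_1,\dots,\lambda_k$ such that $VB_iV^{-1}=\operatorname{diag}(u,\lambda_i)$ for all $i$.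
   Context: $\|\cdot\|_2$ is the operator norm. $\mathcal M_{\mathbb F}(A)=\inf\{\sum_{i=1}^m\|C_i\|_2: m\ge1,\ C_i\in M_2(\mathbb F),\ \exp(C_m)\cdots\exp(C_1)=A\}$ is the Magnus exponent. *)

theory Defs
  imports "HOL-Analysis.Analysis"
begin

primrec mpow :: "'a::real_normed_field^'n^'n \<Rightarrow> nat \<Rightarrow> 'a^'n^'n" where
  "mpow A 0 = mat 1"
| "mpow A (Suc n) = A ** mpow A n"

definition mexp :: "'a::real_normed_field^'n^'n \<Rightarrow> 'a^'n^'n" where
  "mexp A = (\<Sum>n. (1 / fact n) *\<^sub>R mpow A n)"

definition opnorm :: "'a::real_normed_field^'n^'n \<Rightarrow> real" where
  "opnorm A = onorm (\<lambda>x. A *v x)"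

definition prodexp :: "('a::real_normed_field^'n^'n) list \<Rightarrow> 'a^'n^'n" where
  "prodexp Cs = foldl (\<lambda>P C. mexp C ** P) (mat 1) Cs"

definition magnus :: "'a::real_normed_field^'n^'n \<Rightarrow> real" where
  "magnus A = Inf {sum_list (map opnorm Cs) | Cs. Cs \<noteq> [] \<and> prodexp Cs = A}"

definition diag2 :: "'a::zero \<Rightarrow> 'a \<Rightarrow> 'a^2^2" where
  "diag2 a b = (\<chi> i j. if i = j then (if i = 1 then a else b) else 0)"

definition cnj_transpose :: "complex^'n^'m \<Rightarrow> complex^'m^'n" where
  "cnj_transpose A = (\<chi> i j. cnj (A $ j $ i))"

definition unitary_matrix :: "complex^'n^'n \<Rightarrow> bool" where
  "unitary_matrix V \<longleftrightarrow> cnj_transpose V ** V = mat 1 \<and> V ** cnj_transpose V = mat 1"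

end

theory Submission
  imports Defs
begin

text \<open>
  A factorization \<open>exp C\<^sub>m \<cdots> exp C\<^sub>1\<close> is called minimal if no factorization of the same matrix has a
  smaller sum of norms; contiguous parts of a minimal factorization are minimal. Suppose
  \<open>exp (s b) exp (t a)\<close> is minimal with \<open>a\<close>, \<open>b\<close> of norm one. For \<open>T < t\<close>, move a small piece of the
  exponent across \<open>P = exp (T a)\<close>; comparison to first order shows \<open>\<parallel>c\<parallel> + \<parallel>d\<parallel> \<ge> 2\<close> whenever
  \<open>c + P d P\<^sup>-\<^sup>1 = a + b\<close>. With \<open>d\<close> a small multiple of a rank one matrix this yields, when the unit
  vector \<open>u\<close> with \<open>\<parallel>(a + b) u\<parallel> = 2\<close> is unique up to a phase, the identity
  \<open>\<langle>a x, w\<rangle> = \<parallel>x\<parallel>\<^sup>2 \<langle>a u, P w\<rangle>\<close> for \<open>x = P\<^sup>-\<^sup>1 u\<close>. Its derivative at \<open>T = 0\<close> reads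
  \<open>a v = 2 \<langle>u, v\<rangle> v - u\<close> with \<open>v = a u = b u\<close>, and reversing time gives the same for \<open>b\<close>. Hence
  \<open>a v = b v\<close> is a unit vector, so \<open>v\<close> is again a multiple of \<open>u\<close>. If \<open>u\<close> is not unique up to a phase,
  then, in dimension two, \<open>a = b\<close> is an isometry. In both cases \<open>a\<close> and \<open>b\<close> commute, so the
  factors of a minimal product may be permuted, every two of them form a minimal pair, and the norm
  of the sum of the exponents is the sum of their norms; this provides a single \<open>u\<close> for all factors.
\<close>

section \<open>Exponentials in a Banach algebra\<close>

lemma norm_power_diff_le:
  fixes x y :: "'b::real_normed_algebra_1"
  assumes "norm x \<le> r" "norm y \<le> r"
  shows "norm (x ^ Suc n - y ^ Suc n) \<le> real (Suc n) * r ^ n * norm (x - y)"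
proof (induction n)
  case (Suc n)
  have r: "0 \<le> r" using assms norm_ge_zero order_trans by blast
  have eq: "x ^ Suc (Suc n) - y ^ Suc (Suc n) = x * (x ^ Suc n - y ^ Suc n) + (x - y) * y ^ Suc n"
    by (simp add: algebra_simps)
  have "norm (x ^ Suc (Suc n) - y ^ Suc (Suc n))
      \<le> norm x * norm (x ^ Suc n - y ^ Suc n) + norm (x - y) * norm (y ^ Suc n)"
    unfolding eq by (intro norm_triangle_le add_mono norm_mult_ineq)
  also have "\<dots> \<le> r * (real (Suc n) * r ^ n * norm (x - y)) + norm (x - y) * r ^ Suc n"
    using assms r Suc.IH
    by (intro add_mono mult_mono order_trans[OF norm_power_ineq power_mono]) auto
  also have "\<dots> = real (Suc (Suc n)) * r ^ Suc n * norm (x - y)"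
    by (simp add: algebra_simps)
  finally show ?case .
qed simp

text \<open>Termwise from \<open>norm_power_diff_le\<close>: the factor \<open>n\<close> gained
  there turns \<open>r ^ (n - 1) / fact n\<close> into \<open>r ^ (n - 1) / fact (n - 1)\<close>,
  and the sum of these over \<open>n \<ge> 2\<close> is \<open>exp r - 1\<close>.\<close>

lemma exp_remainder_lipschitz:
  fixes x y :: "'b::{real_normed_algebra_1,banach}"
  assumes "norm x \<le> r" "norm y \<le> r"
  shows "norm ((exp x - 1 - x) - (exp y - 1 - y)) \<le> (exp r - 1) * norm (x - y)"
proof -
  have tail: "(\<lambda>n. z ^ (n + 2) /\<^sub>R fact (n + 2)) sums (exp z - 1 - z)" for z :: 'b
    using sums_split_initial_segment[OF exp_converges[of z], of 2]
    by (simp add: numeral_2_eq_2 algebra_simps)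
  have d: "(\<lambda>n. x ^ (n + 2) /\<^sub>R fact (n + 2) - y ^ (n + 2) /\<^sub>R fact (n + 2))
      sums ((exp x - 1 - x) - (exp y - 1 - y))"
    by (intro sums_diff tail)
  have e: "(\<lambda>n. r ^ Suc n /\<^sub>R fact (Suc n) * norm (x - y)) sums ((exp r - 1) * norm (x - y))"
    using sums_split_initial_segment[OF exp_converges[of r], of 1] by (intro sums_mult2) simp
  have le: "norm (x ^ (n + 2) /\<^sub>R fact (n + 2) - y ^ (n + 2) /\<^sub>R fact (n + 2))
      \<le> r ^ Suc n /\<^sub>R fact (Suc n) * norm (x - y)" for n
  proof -
    have "norm (x ^ (n + 2) /\<^sub>R fact (n + 2) - y ^ (n + 2) /\<^sub>R fact (n + 2))
        = norm (x ^ Suc (Suc n) - y ^ Suc (Suc n)) / fact (Suc (Suc n))"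
      by (simp flip: scaleR_right_diff_distrib add: divide_inverse)
    also have "\<dots> \<le> (real (Suc (Suc n)) * r ^ Suc n * norm (x - y)) / fact (Suc (Suc n))"
      using norm_power_diff_le[OF assms, of "Suc n"] by (intro divide_right_mono) auto
    also have "\<dots> = r ^ Suc n / fact (Suc n) * norm (x - y)"
      unfolding fact_Suc[of "Suc n"] by (simp del: fact_Suc power_Suc of_nat_Suc)
    finally show ?thesis by (simp add: divide_inverse mult_ac)
  qed
  have "norm (\<Sum>n. x ^ (n + 2) /\<^sub>R fact (n + 2) - y ^ (n + 2) /\<^sub>R fact (n + 2))
      \<le> (\<Sum>n. r ^ Suc n /\<^sub>R fact (Suc n) * norm (x - y))"
    using le by (intro norm_suminf_le sums_summable[OF e]) blast
  then show ?thesis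
    unfolding sums_unique[OF d, symmetric] sums_unique[OF e, symmetric] .
qed

text \<open>A local logarithm: \<open>exp x = 1 + z\<close> is the fixed point equation for
  \<open>h\<close>. The bound \<open>1/6\<close> keeps the ball within radius \<open>1/3\<close>,
  where the remainder \<open>f\<close> has Lipschitz constant \<open>1/2\<close>.\<close>

lemma exp_onto_near_one:
  fixes z :: "'b::{real_normed_algebra_1,banach}"
  assumes "norm z \<le> 1/6"
  obtains x where "exp x = 1 + z" "norm x \<le> 2 * norm z"
proof -
  define f where "f x = exp x - 1 - x" for x :: 'b
  define h where "h x = z - f x" for x
  let ?S = "cball (0::'b) (2 * norm z)"
  have "exp (1/3) \<le> 1 + 1/3 + (1/3::real)\<^sup>2" by (rule exp_bound) auto
  then have third: "exp (1/3) - 1 \<le> (1/2::real)" by (simp add: power2_eq_square)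
  have lip: "norm (f x - f y) \<le> 1/2 * norm (x - y)" if "norm x \<le> 1/3" "norm y \<le> 1/3" for x y
    using exp_remainder_lipschitz[OF that] mult_right_mono[OF third norm_ge_zero[of "x - y"]]
    unfolding f_def by linarith
  have "\<exists>!x\<in>?S. h x = x"
  proof (rule Banach_fix[where c = "1/2"])
    show "h ` ?S \<subseteq> ?S"
    proof clarify
      fix x assume "x \<in> ?S"
      then have x: "norm x \<le> 2 * norm z" by simp
      have "norm (f x - f 0) \<le> 1/2 * norm (x - 0)" using assms x by (intro lip) auto
      then have "norm (f x) \<le> 1/2 * norm x" by (simp add: f_def)
      then show "h x \<in> ?S"
        using x norm_triangle_ineq4[of z "f x"] by (simp add: h_def)
    qed
    show "dist (h x) (h y) \<le> 1/2 * dist x y" if "x \<in> ?S" "y \<in> ?S" for x y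
      using lip[of y x] that assms by (simp add: h_def dist_norm norm_minus_commute)
  qed (auto simp: complete_eq_closed)
  then obtain x where "norm x \<le> 2 * norm z" "h x = x" by auto
  then show thesis by (intro that[of x]) (auto simp: h_def f_def algebra_simps)
qed

lemma exp_intertwine:
  fixes a b p :: "'b::{real_normed_algebra_1,banach}"
  assumes "a * p = p * b"
  shows "exp a * p = p * exp b"
proof -
  have pow: "a ^ n * p = p * b ^ n" for n
    by (induction n) (auto simp: mult.assoc assms, metis assms mult.assoc)
  have "exp a * p = (\<Sum>n. (a ^ n /\<^sub>R fact n) * p)"
    unfolding exp_def by (rule suminf_mult2[OF summable_exp_generic])
  also have "\<dots> = (\<Sum>n. p * (b ^ n /\<^sub>R fact n))"
    by (simp add: pow)
  also have "\<dots> = p * exp b"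
    unfolding exp_def by (rule suminf_mult[OF summable_exp_generic])
  finally show ?thesis .
qed

section \<open>Products of exponentials and their minimality\<close>

primrec expprod :: "'b::{real_normed_algebra_1,banach} list \<Rightarrow> 'b" where
  "expprod [] = 1"
| "expprod (c # cs) = expprod cs * exp c"

text \<open>Minimality is stated without an infimum; the empty list, with product 1, is among the
  competitors. In \<open>expprod\<close> the head of the list is the rightmost factor, so
  \<open>[x, y]\<close> stands for \<open>exp y * exp x\<close>.\<close>

definition exp_minimal :: "'b::{real_normed_algebra_1,banach} list \<Rightarrow> bool" where
  "exp_minimal cs \<longleftrightarrow>
    (\<forall>ds. expprod ds = expprod cs \<longrightarrow> sum_list (map norm cs) \<le> sum_list (map norm ds))"

lemma expprod_append: "expprod (cs @ ds) = expprod ds * expprod cs"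
  by (induction cs) (auto simp: mult.assoc)

lemma exp_minimalD:
  "exp_minimal cs \<Longrightarrow> expprod ds = expprod cs \<Longrightarrow>
    sum_list (map norm cs) \<le> sum_list (map norm ds)"
  unfolding exp_minimal_def by blast

lemma exp_minimal_replace:
  assumes "exp_minimal (us @ cs @ vs)" "expprod ds = expprod cs"
    "sum_list (map norm ds) = sum_list (map norm cs)"
  shows "exp_minimal (us @ ds @ vs)"
  using assms unfolding exp_minimal_def by (auto simp: expprod_append)

lemma exp_minimal_infix:
  assumes "exp_minimal (us @ cs @ vs)"
  shows "exp_minimal cs"
  unfolding exp_minimal_def
proof (intro allI impI)
  fix ds assume "expprod ds = expprod cs"
  then have "expprod (us @ ds @ vs) = expprod (us @ cs @ vs)" by (simp add: expprod_append)
  from exp_minimalD[OF assms this]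
  show "sum_list (map norm cs) \<le> sum_list (map norm ds)" by simp
qed

lemma expprod_uminus_rev: "expprod (map uminus (rev cs)) * expprod cs = 1"
proof (induction cs)
  case (Cons c cs)
  have "exp (- c) * exp c = 1" using exp_minus_inverse[of "- c"] by simp
  then show ?case using Cons by (simp add: expprod_append) (metis mult.assoc mult_1_left)
qed simp

text \<open>Reversing a list and negating its entries inverts the product and keeps the norms, so
  competitors for the inverse and for the original product correspond.\<close>

lemma exp_minimal_uminus_rev:
  assumes "exp_minimal cs"
  shows "exp_minimal (map uminus (rev cs))"
  unfolding exp_minimal_def
proof (intro allI impI)
  fix ds assume eq: "expprod ds = expprod (map uminus (rev cs))"
  have "expprod (map uminus (rev ds)) = expprod (map uminus (rev ds)) * (expprod ds * expprod cs)"
    using expprod_uminus_rev[of cs] eq by simp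
  also have "\<dots> = expprod cs"
    using expprod_uminus_rev[of ds] by (simp flip: mult.assoc)
  finally have "sum_list (map norm cs) \<le> sum_list (map norm (map uminus (rev ds)))"
    by (rule exp_minimalD[OF assms])
  then show "sum_list (map norm (map uminus (rev cs))) \<le> sum_list (map norm ds)"
    by (simp add: o_def rev_map[symmetric])
qed

lemma expprod_split:
  assumes "r + s = t"
  shows "expprod [r *\<^sub>R a, s *\<^sub>R a] = expprod [t *\<^sub>R a]"
proof -
  have "exp (s *\<^sub>R a) * exp (r *\<^sub>R a) = exp (s *\<^sub>R a + r *\<^sub>R a)"
    by (rule exp_add_commuting[symmetric]) simp
  then show ?thesis using assms by (simp add: scaleR_add_left[symmetric] add.commute)
qed

lemma exp_minimal_split:
  assumes "exp_minimal (us @ [t *\<^sub>R a] @ vs)" "r + s = t" "r \<ge> 0" "s \<ge> 0"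
  shows "exp_minimal (us @ [r *\<^sub>R a, s *\<^sub>R a] @ vs)"
  using assms(2-) by (intro exp_minimal_replace[OF assms(1)] expprod_split) (auto simp: algebra_simps)

text \<open>The part \<open>exp (h *\<^sub>R b) * P * exp (h *\<^sub>R a)\<close> of the minimal
  product spends \<open>2 * h\<close> outside \<open>P\<close>. Its outer exponents are exchanged
  for multiples of \<open>c\<close> and \<open>d\<close>. The condition on \<open>c\<close> and
  \<open>d\<close> makes the first-order terms agree, so one extra factor \<open>exp X\<close> with
  \<open>norm X \<le> e * h\<close> repairs the error.\<close>

lemma exp_minimal_first_variation:
  fixes a b :: "'b::{real_normed_algebra_1,banach}"
  assumes min: "exp_minimal [t *\<^sub>R a, s *\<^sub>R b]" and norms: "norm a = 1" "norm b = 1"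
    and s: "s > 0" and T: "0 < T" "T < t"
    and cd: "c + exp (T *\<^sub>R a) * d * exp (- (T *\<^sub>R a)) = a + b"
  shows "2 \<le> norm c + norm d"
proof (rule field_le_epsilon)
  fix e :: real assume e: "e > 0"
  define P where "P = exp (T *\<^sub>R a)"
  define E where "E = P * d * exp (- (T *\<^sub>R a))"
  \<comment> \<open>The discrepancy between the two products:
    \<open>exp (h *\<^sub>R c) * G h * P * exp (h *\<^sub>R d)\<close> equals
    \<open>exp (h *\<^sub>R b) * P * exp (h *\<^sub>R a)\<close>. It is 1 at \<open>h = 0\<close>,
    with vanishing derivative by \<open>cd\<close>.\<close>
  define G where "G h = exp (h *\<^sub>R - c) * (exp (h *\<^sub>R b) * (exp (h *\<^sub>R a) * exp (h *\<^sub>R - E)))" for h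
  have EP: "E * P = P * d"
    using exp_minus_inverse[of "- (T *\<^sub>R a)"] by (simp add: E_def P_def mult.assoc)
  note der = exp_scaleR_has_vector_derivative_right[where t=0, unfolded scaleR_zero_left exp_zero mult_1_left]
  have "(G has_vector_derivative (- c + (b + (a - E)))) (at 0)"
    unfolding G_def
    by (rule has_vector_derivative_eq_rhs, (rule has_vector_derivative_mult der)+) auto
  moreover have "- c + (b + (a - E)) = 0" using cd unfolding E_def P_def by (simp add: algebra_simps)
  ultimately have "(G has_derivative (\<lambda>h. 0)) (at 0)"
    by (simp add: has_vector_derivative_def)
  moreover have "G 0 = 1" by (simp add: G_def)
  ultimately have "\<forall>e>0. \<exists>r>0. \<forall>h. norm h < r \<longrightarrow> norm (G h - 1) \<le> e * norm h"
    unfolding has_derivative_at_alt by simp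
  then obtain r where r: "r > 0" "\<And>h. norm h < r \<Longrightarrow> norm (G h - 1) \<le> (e/2) * norm h"
    using e half_gt_zero by blast
  \<comment> \<open>The bounds serve, in turn, the first-order estimate, the room to cut a piece of
    length \<open>h\<close> off each of the two exponents, and the bound \<open>1/6\<close> in
    \<open>exp_onto_near_one\<close>.\<close>
  define h where "h = Min {r/2, s, t - T, 1 / (3 * e)}"
  have h: "h > 0" "h < r" "h \<le> s" "h \<le> t - T" "h \<le> 1 / (3 * e)"
  proof -
    show "h > 0" using r s T e unfolding h_def by (subst Min_gr_iff) auto
    have "h \<le> r/2" "h \<le> s" "h \<le> t - T" "h \<le> 1 / (3 * e)" unfolding h_def by (rule Min_le; simp)+
    then show "h < r" "h \<le> s" "h \<le> t - T" "h \<le> 1 / (3 * e)" using r by auto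
  qed
  have Gh: "norm (G h - 1) \<le> (e/2) * h" using r(2)[of h] h by simp
  moreover have "(e/2) * h \<le> 1/6" using h(5) e by (simp add: field_simps)
  ultimately obtain X where X: "exp X = 1 + (G h - 1)" "norm X \<le> 2 * norm (G h - 1)"
    using exp_onto_near_one[of "G h - 1"] by force
  have neX: "norm X \<le> e * h" using X(2) Gh by simp
  \<comment> \<open>Cutting \<open>t\<close> into \<open>t - h - T\<close>, \<open>h\<close>,
    \<open>T\<close> and \<open>s\<close> into \<open>h\<close>, \<open>s - h\<close> isolates the
    three middle factors as a minimal list.\<close>
  have "exp_minimal ([(t - h - T) *\<^sub>R a, (h + T) *\<^sub>R a] @ [s *\<^sub>R b])"
    using exp_minimal_split[of "[]" t a "[s *\<^sub>R b]" "t - h - T" "h + T"] min h T by simp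
  then have "exp_minimal ([(t - h - T) *\<^sub>R a, h *\<^sub>R a, T *\<^sub>R a] @ [s *\<^sub>R b])"
    using exp_minimal_split[of "[(t - h - T) *\<^sub>R a]" "h + T" a "[s *\<^sub>R b]" h T] h T by simp
  then have "exp_minimal ([(t - h - T) *\<^sub>R a] @ [h *\<^sub>R a, T *\<^sub>R a, h *\<^sub>R b] @ [(s - h) *\<^sub>R b])"
    using exp_minimal_split[of "[(t - h - T) *\<^sub>R a, h *\<^sub>R a, T *\<^sub>R a]" s b "[]" h "s - h"] h by simp
  then have min': "exp_minimal [h *\<^sub>R a, T *\<^sub>R a, h *\<^sub>R b]" by (rule exp_minimal_infix)
  have "exp (h *\<^sub>R - E) * P = P * exp (h *\<^sub>R - d)"
    by (rule exp_intertwine) (simp add: EP)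
  then have "G h * P = exp (h *\<^sub>R - c) * (exp (h *\<^sub>R b) * (exp (h *\<^sub>R a) * (P * exp (h *\<^sub>R - d))))"
    unfolding G_def by (simp add: mult.assoc)
  moreover have "exp (h *\<^sub>R a) * P = P * exp (h *\<^sub>R a)"
    unfolding P_def by (rule exp_intertwine) (simp add: exp_times_scaleR_commute)
  moreover have "exp (h *\<^sub>R - d) * exp (h *\<^sub>R d) = 1" "exp (h *\<^sub>R c) * exp (h *\<^sub>R - c) = 1"
    using exp_minus_inverse[of "- (h *\<^sub>R d)"] exp_minus_inverse[of "h *\<^sub>R c"] by auto
  ultimately have "exp (h *\<^sub>R c) * (G h * P) * exp (h *\<^sub>R d) = exp (h *\<^sub>R b) * P * exp (h *\<^sub>R a)"
    by (metis mult.assoc mult_1_left mult_1_right)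
  then have "expprod [h *\<^sub>R d, T *\<^sub>R a, X, h *\<^sub>R c] = expprod [h *\<^sub>R a, T *\<^sub>R a, h *\<^sub>R b]"
    by (simp add: X(1) P_def mult.assoc)
  from exp_minimalD[OF min' this]
  have "2 * h \<le> h * (norm c + norm d) + e * h"
    using neX norms h T by (simp add: algebra_simps)
  also have "\<dots> = h * (norm c + norm d + e)" by (simp add: algebra_simps)
  finally show "2 \<le> norm c + norm d + e" using h by simp
qed

section \<open>Permuting the factors of a minimal product\<close>

text \<open>Commuting neighbours can be exchanged at no cost, so \<open>x\<close> moves past every
  factor that precedes \<open>y\<close>, and the factors it has passed are dropped.\<close>

lemma exp_minimal_tail_pairs:
  assumes comm: "\<And>x y :: 'b::{real_normed_algebra_1,banach}. exp_minimal [x, y] \<Longrightarrow> x * y = y * x"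
    and "exp_minimal (x # ys)" "y \<in> set ys"
  shows "exp_minimal [x, y :: 'b]"
  using assms(2,3)
proof (induction ys)
  case (Cons z zs)
  have xz: "exp_minimal [x, z]"
    using exp_minimal_infix[of "[]" "[x, z]" zs] Cons.prems by simp
  show ?case
  proof (cases "y = z")
    case False
    have "expprod [z, x] = expprod [x, z]"
      using exp_add_commuting[OF comm[OF xz]] exp_add_commuting[OF comm[OF xz, symmetric]]
      by (simp add: add.commute)
    then have "exp_minimal (z # x # zs)"
      using exp_minimal_replace[of "[]" "[x, z]" zs "[z, x]"] Cons.prems by simp
    then have "exp_minimal (x # zs)" using exp_minimal_infix[of "[z]" "x # zs" "[]"] by simp
    then show ?thesis using Cons False by auto
  qed (use xz in simp)
qed simp

lemma exp_minimal_pairs: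
  assumes comm: "\<And>x y :: 'b::{real_normed_algebra_1,banach}. exp_minimal [x, y] \<Longrightarrow> x * y = y * x"
    and "exp_minimal (xs :: 'b list)"
  shows "sorted_wrt (\<lambda>x y. exp_minimal [x, y]) xs"
  using assms(2)
proof (induction xs)
  case (Cons x xs)
  then show ?case
    using exp_minimal_tail_pairs[OF comm, of x xs] exp_minimal_infix[of "[x]" xs "[]"] by auto
qed simp

lemma expprod_commuting:
  assumes "sorted_wrt (\<lambda>x y. x * y = y * x) xs"
  shows "expprod xs = exp (sum_list xs)"
  using assms
proof (induction xs)
  case (Cons x xs)
  have "sum_list xs * x = x * sum_list xs"
    using Cons.prems by (induction xs) (auto simp: distrib_left distrib_right)
  then show ?case
    using Cons exp_add_commuting[of "sum_list xs" x] by (simp add: add.commute)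
qed simp

text \<open>All factors commute, so the one-element list \<open>[sum_list xs]\<close> has the same
  product and is a competitor.\<close>

lemma exp_minimal_norm_sum_list:
  assumes comm: "\<And>x y :: 'b::{real_normed_algebra_1,banach}. exp_minimal [x, y] \<Longrightarrow> x * y = y * x"
    and min: "exp_minimal (xs :: 'b list)"
  shows "sum_list (map norm xs) \<le> norm (sum_list xs)"
proof -
  have "sorted_wrt (\<lambda>x y. x * y = y * x) xs"
    by (rule sorted_wrt_mono_rel[OF _ exp_minimal_pairs[OF comm min]]) (auto intro: comm)
  then have "expprod [sum_list xs] = expprod xs" by (simp add: expprod_commuting)
  from exp_minimalD[OF min this] show ?thesis by simp
qed

section \<open>Square matrices with the operator norm as a Banach algebra\<close>

text \<open>A copy of the matrices, since \<open>'a^'n^'n\<close> itself carries the Euclidean norm.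
  With the matrix product and the operator norm as its structure, the general \<open>exp\<close>
  applies. The sort covers \<open>real\<close> and \<open>complex\<close> together.\<close>

typedef (overloaded) ('a, 'n) sqmat = "UNIV :: ('a::{real_normed_field,euclidean_space}^'n::finite^'n) set"
  morphisms of_sqmat to_sqmat
  by simp

setup_lifting type_definition_sqmat

lift_definition act :: "('a::{real_normed_field,euclidean_space}, 'n::finite) sqmat \<Rightarrow> 'a^'n \<Rightarrow> 'a^'n"
  is "(*v)" .

lemma of_to_sqmat [simp]: "of_sqmat (to_sqmat A) = A"
  by (simp add: to_sqmat_inverse)

lemma act_bounded_linear: "bounded_linear (act A)"
  unfolding act.rep_eq by (rule matrix_vector_mul_bounded_linear)

lemma sqmat_eqI: "(\<And>x. act A x = act B x) \<Longrightarrow> A = B"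
  by transfer (simp add: matrix_eq)

instantiation sqmat :: ("{real_normed_field,euclidean_space}", finite) real_normed_algebra_1
begin

lift_definition zero_sqmat :: "('a, 'b) sqmat" is 0 .
lift_definition one_sqmat :: "('a, 'b) sqmat" is "mat 1" .
lift_definition plus_sqmat :: "('a, 'b) sqmat \<Rightarrow> ('a, 'b) sqmat \<Rightarrow> ('a, 'b) sqmat" is "(+)" .
lift_definition minus_sqmat :: "('a, 'b) sqmat \<Rightarrow> ('a, 'b) sqmat \<Rightarrow> ('a, 'b) sqmat" is "(-)" .
lift_definition uminus_sqmat :: "('a, 'b) sqmat \<Rightarrow> ('a, 'b) sqmat" is uminus .
lift_definition times_sqmat :: "('a, 'b) sqmat \<Rightarrow> ('a, 'b) sqmat \<Rightarrow> ('a, 'b) sqmat" is "(**)" .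
lift_definition scaleR_sqmat :: "real \<Rightarrow> ('a, 'b) sqmat \<Rightarrow> ('a, 'b) sqmat" is "(*\<^sub>R)" .
lift_definition norm_sqmat :: "('a, 'b) sqmat \<Rightarrow> real" is opnorm .

definition sgn_sqmat :: "('a, 'b) sqmat \<Rightarrow> ('a, 'b) sqmat"
  where "sgn_sqmat A = inverse (norm A) *\<^sub>R A"

definition dist_sqmat :: "('a, 'b) sqmat \<Rightarrow> ('a, 'b) sqmat \<Rightarrow> real"
  where "dist_sqmat A B = norm (A - B)"

definition uniformity_sqmat :: "(('a, 'b) sqmat \<times> ('a, 'b) sqmat) filter"
  where "uniformity_sqmat = (INF e\<in>{0 <..}. principal {(x, y). dist x y < e})"

definition open_sqmat :: "('a, 'b) sqmat set \<Rightarrow> bool"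
  where "open_sqmat S = (\<forall>x\<in>S. \<forall>\<^sub>F (x', y) in uniformity. x' = x \<longrightarrow> y \<in> S)"

lemma act_plus: "act (A + B) x = act A x + act B x" for A B :: "('a, 'b) sqmat"
  by transfer (rule matrix_vector_mult_add_rdistrib)

lemma act_times: "act (A * B) x = act A (act B x)" for A B :: "('a, 'b) sqmat"
  by transfer (simp add: matrix_vector_mul_assoc)

lemma act_scaleR: "act (r *\<^sub>R A) x = r *\<^sub>R act A x" for A :: "('a, 'b) sqmat"
  by transfer (simp add: matrix_vector_mult_def vec_eq_iff scaleR_sum_right)

lemma act_zero: "act 0 x = 0" for x :: "'a^'b"
  by transfer simp

lemma act_one: "act 1 x = x" for x :: "'a^'b"
  by transfer simp

lemma norm_sqmat_eq_onorm: "norm A = onorm (act A)" for A :: "('a, 'b) sqmat"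
  by transfer (simp add: opnorm_def)

instance
proof
  fix A B C :: "('a, 'b) sqmat" and r q :: real
  note sqmat_simps = act_plus act_times act_scaleR act_zero act_one
  show "A + B + C = A + (B + C)" "A + B = B + A" "0 + A = A" "r *\<^sub>R (A + B) = r *\<^sub>R A + r *\<^sub>R B"
    "(r + q) *\<^sub>R A = r *\<^sub>R A + q *\<^sub>R A" "r *\<^sub>R q *\<^sub>R A = (r * q) *\<^sub>R A" "1 *\<^sub>R A = A"
    "- A + A = 0" "A - B = A + - B"
    by (transfer; simp add: algebra_simps)+
  show "A * B * C = A * (B * C)" "(A + B) * C = A * C + B * C" "1 * A = A" "A * 1 = A"
    "r *\<^sub>R A * B = r *\<^sub>R (A * B)"
    by (rule sqmat_eqI; simp add: sqmat_simps)+
  show "A * (B + C) = A * B + A * C" "A * r *\<^sub>R B = r *\<^sub>R (A * B)"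
    using act_bounded_linear[of A]
    by (intro sqmat_eqI, simp add: sqmat_simps linear_simps)+
  show "(0 :: ('a, 'b) sqmat) \<noteq> 1"
    using act_zero[of "1 :: 'a^'b"] act_one[of "1 :: 'a^'b"] by (metis zero_neq_one)
  show "dist A B = norm (A - B)" "sgn A = inverse (norm A) *\<^sub>R A"
    by (rule dist_sqmat_def sgn_sqmat_def)+
  show "uniformity = (INF e\<in>{0 <..}. principal {(x, y :: ('a, 'b) sqmat). dist x y < e})"
    by (rule uniformity_sqmat_def)
  show "open U = (\<forall>x\<in>U. \<forall>\<^sub>F (x', y) in uniformity. x' = x \<longrightarrow> y \<in> U)" for U :: "('a, 'b) sqmat set"
    by (rule open_sqmat_def)
  show "(norm A = 0) = (A = 0)"
    unfolding norm_sqmat_eq_onorm onorm_eq_0[OF act_bounded_linear]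
    by (auto intro: sqmat_eqI simp: act_zero)
  show "norm (A + B) \<le> norm A + norm B"
    unfolding norm_sqmat_eq_onorm act_plus[abs_def]
    using onorm_triangle[OF act_bounded_linear act_bounded_linear] by auto
  show "norm (r *\<^sub>R A) = \<bar>r\<bar> * norm A"
    unfolding norm_sqmat_eq_onorm
    using onorm_scaleR[OF act_bounded_linear, of r A] by (simp add: act_scaleR[abs_def])
  show "norm (A * B) \<le> norm A * norm B"
    unfolding norm_sqmat_eq_onorm
    using onorm_compose[OF act_bounded_linear act_bounded_linear, of A B]
    by (simp add: o_def act_times[abs_def])
  show "norm (1 :: ('a, 'b) sqmat) = 1"
    unfolding norm_sqmat_eq_onorm using onorm_id by (simp add: act_one[abs_def])
qed

end

lemmas act_simps [simp] = act_plus act_times act_scaleR act_zero act_one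

lemma act_minus [simp]: "act (A - B) x = act A x - act B x"
  using act_plus[of "A - B" B x] by (simp add: algebra_simps)

lemma act_uminus [simp]: "act (- A) x = - act A x"
  using act_minus[of 0 A x] by simp

lemmas act_linear_simps [simp] = linear_simps[OF act_bounded_linear]

lemma act_vector_scalar [simp]: "act A (c *s x) = c *s act A x"
  by transfer (rule vector_scalar_commute)

lemma norm_act_le: "norm (act A x) \<le> norm A * norm x"
  unfolding norm_sqmat_eq_onorm by (rule onorm[OF act_bounded_linear])

lemma norm_sqmat_le: "(\<And>x. norm (act A x) \<le> b * norm x) \<Longrightarrow> norm A \<le> b"
  unfolding norm_sqmat_eq_onorm by (rule onorm_le)

lemma norm_act_le_1: "norm A \<le> 1 \<Longrightarrow> norm (act A x) \<le> norm x"
  using norm_act_le[of A x] mult_right_mono[of "norm A" 1 "norm x"] by simp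

lemma bounded_linear_act_left: "bounded_linear (\<lambda>A. act A x)"
  by (rule bounded_linear_intro[where K = "norm x"]) (simp_all add: norm_act_le)

lemma norm_vector_scalar: "norm (c *s x) = norm c * norm x"
  for x :: "'a::real_normed_field^'n"
  unfolding norm_vec_def by (simp add: norm_mult L2_set_right_distrib)

text \<open>The norm of the image has a maximum on the compact unit sphere, and homogeneity extends
  the bound to all vectors.\<close>

lemma exists_norm_attained: "\<exists>x. norm x = 1 \<and> norm (act A x) = norm A"
proof -
  have "continuous_on (sphere 0 1) (\<lambda>x. norm (act A x))"
    by (intro continuous_intros linear_continuous_on act_bounded_linear)
  moreover have "sphere (0 :: 'a^'b) 1 \<noteq> {}"
    using vector_choose_size[of 1] by (auto simp: sphere_def dist_norm)
  ultimately obtain x where x: "norm x = 1" "\<And>y. norm y = 1 \<Longrightarrow> norm (act A y) \<le> norm (act A x)"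
    using continuous_attains_sup[OF compact_sphere, of 0 1 "\<lambda>x. norm (act A x)"] by auto
  have "norm A \<le> norm (act A x)"
  proof (rule norm_sqmat_le)
    fix y
    show "norm (act A y) \<le> norm (act A x) * norm y"
    proof (cases "y = 0")
      case False
      then show ?thesis using x(2)[of "y /\<^sub>R norm y"] by (simp add: field_simps)
    qed simp
  qed
  then show ?thesis using x(1) norm_act_le[of A x] by (intro exI[of _ x]) simp
qed

section \<open>Comparison with the entries, completeness, and passage to \<open>mexp\<close>\<close>

lemma norm_entry_le: "norm (of_sqmat A $ i $ j) \<le> norm A"
proof -
  have "act A (axis j 1) $ i = of_sqmat A $ i $ j"
    by (simp add: act.rep_eq matrix_vector_mult_def axis_def if_distrib cong: if_cong)
  moreover have "norm (axis j 1 :: 'a^'b) = 1"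
    by (simp add: norm_vec_def axis_def L2_set_def if_distrib[of norm]
        if_distrib[of "\<lambda>x. x\<^sup>2"] cong: if_cong)
  ultimately show ?thesis
    using Finite_Cartesian_Product.norm_nth_le[of "act A (axis j 1)" i] norm_act_le[of A "axis j 1"] by simp
qed

text \<open>One half of the equivalence of norms; \<open>norm_sqmat_le_sum\<close> is the other.
  This half carries Cauchy sequences and the exponential series over to matrices, the other brings
  limits back.\<close>

lemma bounded_linear_of_sqmat: "bounded_linear of_sqmat"
proof (rule bounded_linear_intro)
  fix A :: "('a, 'b) sqmat"
  have "norm (of_sqmat A) \<le> (\<Sum>i\<in>UNIV. norm (of_sqmat A $ i))"
    unfolding norm_vec_def by (rule L2_set_le_sum) simp
  also have "\<dots> \<le> (\<Sum>i\<in>UNIV. \<Sum>j\<in>UNIV. norm (of_sqmat A $ i $ j))"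
    unfolding norm_vec_def by (intro sum_mono L2_set_le_sum) simp
  also have "\<dots> \<le> (\<Sum>i\<in>(UNIV::'b set). \<Sum>j\<in>(UNIV::'b set). norm A)"
    by (intro sum_mono norm_entry_le)
  finally show "norm (of_sqmat A) \<le> norm A * (real CARD('b) * real CARD('b))"
    by (simp add: mult_ac)
qed (simp_all add: plus_sqmat.rep_eq scaleR_sqmat.rep_eq)

lemma norm_sqmat_le_sum: "norm A \<le> (\<Sum>i\<in>UNIV. \<Sum>j\<in>UNIV. norm (of_sqmat A $ i $ j))"
proof (rule norm_sqmat_le)
  fix x
  have "norm (act A x) \<le> (\<Sum>i\<in>UNIV. norm (\<Sum>j\<in>UNIV. of_sqmat A $ i $ j * x $ j))"
    unfolding norm_vec_def act.rep_eq by (simp add: matrix_vector_mult_def L2_set_le_sum)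
  also have "\<dots> \<le> (\<Sum>i\<in>UNIV. \<Sum>j\<in>UNIV. norm (of_sqmat A $ i $ j) * norm x)"
    by (intro sum_mono order_trans[OF norm_sum])
      (simp add: norm_mult mult_left_mono Finite_Cartesian_Product.norm_nth_le)
  finally show "norm (act A x) \<le> (\<Sum>i\<in>UNIV. \<Sum>j\<in>UNIV. norm (of_sqmat A $ i $ j)) * norm x"
    by (simp add: sum_distrib_right)
qed

instance sqmat :: ("{real_normed_field,euclidean_space}", finite) banach
proof
  fix X :: "nat \<Rightarrow> ('a, 'b) sqmat"
  assume "Cauchy X"
  then have "Cauchy (\<lambda>n. of_sqmat (X n))"
    by (rule bounded_linear.Cauchy[OF bounded_linear_of_sqmat])
  then obtain L where L: "(\<lambda>n. of_sqmat (X n)) \<longlonglongrightarrow> L"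
    using Cauchy_convergent convergent_def by blast
  have "(\<lambda>n. \<Sum>i\<in>UNIV. \<Sum>j\<in>UNIV. norm (of_sqmat (X n) $ i $ j - L $ i $ j))
      \<longlonglongrightarrow> (\<Sum>i\<in>(UNIV::'b set). \<Sum>j\<in>(UNIV::'b set). norm (L $ i $ j - L $ i $ j))"
    by (intro tendsto_intros L)
  then have "(\<lambda>n. \<Sum>i\<in>UNIV. \<Sum>j\<in>UNIV. norm (of_sqmat (X n - to_sqmat L) $ i $ j)) \<longlonglongrightarrow> 0"
    by (simp add: minus_sqmat.rep_eq)
  then have "(\<lambda>n. X n - to_sqmat L) \<longlonglongrightarrow> 0"
    by (rule Lim_null_comparison[rotated]) (simp add: norm_sqmat_le_sum)
  then show "convergent X"
    using LIM_zero_iff convergent_def by blast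
qed

lemma of_sqmat_power: "of_sqmat (A ^ n) = mpow (of_sqmat A) n"
  by (induction n) (simp_all add: one_sqmat.rep_eq times_sqmat.rep_eq)

lemma mexp_of_sqmat: "mexp (of_sqmat A) = of_sqmat (exp A)"
proof -
  have "of_sqmat (exp A) = (\<Sum>n. of_sqmat (A ^ n /\<^sub>R fact n))"
    unfolding exp_def
    by (rule bounded_linear.suminf[OF bounded_linear_of_sqmat summable_exp_generic])
  then show ?thesis
    by (simp add: mexp_def scaleR_sqmat.rep_eq of_sqmat_power divide_inverse)
qed

lemma prodexp_of_sqmat: "prodexp (map of_sqmat cs) = of_sqmat (expprod cs)"
proof -
  have "foldl (\<lambda>P C. mexp C ** P) (of_sqmat Z) (map of_sqmat cs) = of_sqmat (expprod cs * Z)" for Z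
    by (induction cs arbitrary: Z)
      (simp_all add: mexp_of_sqmat mult.assoc flip: times_sqmat.rep_eq)
  from this[of 1] show ?thesis by (simp add: prodexp_def one_sqmat.rep_eq)
qed

lemma exp_minimal_of_magnus:
  fixes cs :: "('a::{real_normed_field,euclidean_space}, 'n::finite) sqmat list"
  assumes "magnus (prodexp (map of_sqmat cs)) = sum_list (map norm cs)" "cs \<noteq> []"
  shows "exp_minimal cs"
  unfolding exp_minimal_def
proof (intro allI impI)
  fix ds :: "('a, 'n) sqmat list"
  assume eq: "expprod ds = expprod cs"
  let ?S = "{sum_list (map opnorm Cs) | Cs. Cs \<noteq> [] \<and> prodexp Cs = prodexp (map of_sqmat cs)}"
  have "sum_list (map opnorm Cs) \<ge> 0" for Cs :: "('a^'n^'n) list"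
    by (intro sum_list_nonneg)
      (auto simp: opnorm_def onorm_pos_le[OF matrix_vector_mul_bounded_linear])
  then have bdd: "bdd_below ?S" by (intro bdd_belowI[of _ 0]) auto
  \<comment> \<open>A leading zero makes a possibly empty \<open>ds\<close> nonempty, as the set
    behind \<open>magnus\<close> demands, and changes neither product nor cost.\<close>
  have "sum_list (map norm (0 # ds)) \<in> ?S"
  proof (intro CollectI exI conjI)
    show "sum_list (map norm (0 # ds)) = sum_list (map opnorm (map of_sqmat (0 # ds)))"
      unfolding map_map by (simp add: norm_sqmat.rep_eq[abs_def] o_def)
    show "prodexp (map of_sqmat (0 # ds)) = prodexp (map of_sqmat cs)"
      unfolding prodexp_of_sqmat by (simp add: eq)
  qed simp
  from cInf_lower[OF this bdd] show "sum_list (map norm cs) \<le> sum_list (map norm ds)"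
    using assms(1) unfolding magnus_def by simp
qed

section \<open>First variation of a minimal product\<close>

lemma inner_eq_norms_imp_eq:
  fixes x y :: "'v::real_inner"
  assumes "norm x \<le> 1" "norm y \<le> 1" "x \<bullet> y = 1"
  shows "x = y"
proof -
  have "x \<bullet> x \<le> 1" "y \<bullet> y \<le> 1"
    using assms(1,2) by (simp_all add: dot_square_norm power_le_one)
  moreover have "(norm (x - y))\<^sup>2 = x \<bullet> x - 2 * (x \<bullet> y) + y \<bullet> y"
    by (simp add: power2_norm_eq_inner inner_diff inner_commute)
  ultimately have "(norm (x - y))\<^sup>2 \<le> 0" using assms(3) by simp
  then show ?thesis by simp
qed

text \<open>A contraction that keeps the norm of \<open>u\<close> satisfies \<open>y = u\<close> for
  the vector \<open>y\<close> obtained by applying first \<open>A\<close> and then its adjoint to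
  \<open>u\<close>: the norm of \<open>y\<close> is at most that of \<open>u\<close>, while
  \<open>y \<bullet> u = u \<bullet> u\<close>.\<close>

lemma norm_attaining_adjoint:
  assumes A: "norm A \<le> 1" and u: "norm (act A u) = norm u"
  shows "act A u \<bullet> act A z = u \<bullet> z"
proof -
  have lin: "linear (act A)" using act_bounded_linear by (rule bounded_linear.linear)
  define y where "y = adjoint (act A) (act A u)"
  have y: "y \<bullet> w = act A u \<bullet> act A w" for w
    unfolding y_def using adjoint_works[OF lin] by (simp add: inner_commute)
  have "y \<bullet> y \<le> norm (act A u) * norm (act A y)" unfolding y by (rule norm_cauchy_schwarz)
  also have "\<dots> \<le> norm u * norm y" using norm_act_le_1[OF A, of y] u by (simp add: mult_left_mono)
  finally have "norm y * norm y \<le> norm u * norm y" by (simp add: dot_square_norm power2_eq_square)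
  then have "norm y \<le> norm u" by (cases "norm y = 0") auto
  then have yy: "y \<bullet> y \<le> u \<bullet> u" unfolding dot_square_norm by (simp add: power_mono)
  have "y \<bullet> u = u \<bullet> u" unfolding y using u by (simp add: dot_square_norm)
  then have "(norm (y - u))\<^sup>2 \<le> 0"
    using yy by (simp add: power2_norm_eq_inner inner_diff inner_commute)
  then show ?thesis using y[of z] by simp
qed

text \<open>By \<open>split\<close> with \<open>d = e *\<^sub>R E\<close>, subtracting
  \<open>e *\<^sub>R (P * E * Q)\<close> from \<open>X\<close> leaves a norm of at least
  \<open>r - e\<close>. The vector \<open>z\<close> is a limit, as \<open>e\<close> tends to 0, of
  unit vectors at which the perturbed norms are attained; it depends on \<open>E\<close>.\<close>

lemma norm_attaining_direction:
  assumes X: "norm X \<le> r" and E: "norm E \<le> 1"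
    and split: "\<And>c d. c + P * d * Q = X \<Longrightarrow> r \<le> norm c + norm d"
  obtains z where "norm z = 1" "norm (act X z) = r" "act X z \<bullet> act (P * E * Q) z \<le> r"
proof -
  define F where "F = P * E * Q"
  define e where "e n = inverse (real (Suc n))" for n
  have e: "e n > 0" "e \<longlonglongrightarrow> 0" for n
    using LIMSEQ_inverse_real_of_nat by (auto simp: e_def[abs_def])
  have "\<forall>n. \<exists>z. norm z = 1 \<and> norm (act (X - e n *\<^sub>R F) z) = norm (X - e n *\<^sub>R F)"
    using exists_norm_attained by blast
  then obtain z where z: "\<And>n. norm (z n) = 1"
      "\<And>n. norm (act (X - e n *\<^sub>R F) (z n)) = norm (X - e n *\<^sub>R F)"
    by metis
  define g where "g n = act (X - e n *\<^sub>R F) (z n)" for n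
  have g_ge: "r - e n \<le> norm (g n)" for n
  proof -
    have "r \<le> norm (X - e n *\<^sub>R F) + norm (e n *\<^sub>R E)"
      by (rule split) (simp add: F_def)
    moreover have "norm (e n *\<^sub>R E) \<le> e n"
      using E e(1)[of n] by (simp add: mult_left_le)
    ultimately show ?thesis unfolding g_def z(2) by simp
  qed
  \<comment> \<open>Writing G for \<open>norm (g n)\<close>, one has \<open>G * (r - e n) \<le> G *
    G \<le> G * r - e n * (g n \<bullet> act F (z n))\<close>; then \<open>e n\<close>
    cancels.\<close>
  have gF: "g n \<bullet> act F (z n) \<le> norm (g n)" for n
  proof -
    have "norm (act X (z n)) \<le> r" using norm_act_le[of X "z n"] X z(1) by simp
    then have "g n \<bullet> act X (z n) \<le> norm (g n) * r"
      by (intro order_trans[OF norm_cauchy_schwarz] mult_left_mono) auto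
    moreover have "norm (g n) * norm (g n) = g n \<bullet> act X (z n) - e n * (g n \<bullet> act F (z n))"
      by (simp add: g_def inner_diff_right flip: power2_eq_square dot_square_norm)
    moreover have "norm (g n) * (r - e n) \<le> norm (g n) * norm (g n)"
      using g_ge[of n] by (simp add: mult_left_mono)
    ultimately have "e n * (g n \<bullet> act F (z n)) \<le> e n * norm (g n)" by (simp add: algebra_simps)
    then show ?thesis using e(1)[of n] by simp
  qed
  obtain l s where l: "norm l = 1" "strict_mono s" "(z \<circ> s) \<longlonglongrightarrow> l"
    using compact_sphere[of 0 1, unfolded compact_def, rule_format, of z] z(1) by auto
  have es: "(\<lambda>n. e (s n)) \<longlonglongrightarrow> 0"
    using LIMSEQ_subseq_LIMSEQ[OF e(2) l(2)] by (simp add: o_def)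
  have act_lim: "(\<lambda>n. act B (z (s n))) \<longlonglongrightarrow> act B l" for B
    using bounded_linear.tendsto[OF act_bounded_linear l(3)] by (simp add: o_def)
  have "(\<lambda>n. act X (z (s n)) - e (s n) *\<^sub>R act F (z (s n))) \<longlonglongrightarrow> act X l - 0 *\<^sub>R act F l"
    by (intro tendsto_intros act_lim es)
  then have glim: "(\<lambda>n. g (s n)) \<longlonglongrightarrow> act X l" by (simp add: g_def)
  have "r - 0 \<le> norm (act X l)"
    by (rule LIMSEQ_le[OF tendsto_diff[OF tendsto_const es] tendsto_norm[OF glim]])
      (use g_ge in blast)
  moreover have "norm (act X l) \<le> r" using norm_act_le[of X l] X l(1) by simp
  ultimately have "norm (act X l) = r" by simp
  moreover have "act X l \<bullet> act F l \<le> norm (act X l)"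
    by (rule LIMSEQ_le[OF tendsto_inner[OF glim act_lim] tendsto_norm[OF glim]])
      (use gF in blast)
  ultimately show thesis using l(1) by (intro that[of l]) (simp_all add: F_def)
qed

text \<open>The first variation supplies the hypothesis \<open>split\<close> of
  \<open>norm_attaining_direction\<close> for \<open>X = a + b\<close> and \<open>r = 2\<close>. Two
  vectors in the unit ball whose sum has norm 2 are equal unit vectors.\<close>

lemma exp_minimal_common_direction:
  assumes min: "exp_minimal [t *\<^sub>R a, s *\<^sub>R b]" and norms: "norm a = 1" "norm b = 1"
    and s: "s > 0" and T: "0 < T" "T < t" and E: "norm E \<le> 1"
  obtains z where "norm z = 1" "act a z = act b z" "norm (act a z) = 1"
    "act a z \<bullet> act (exp (T *\<^sub>R a) * E * exp (- (T *\<^sub>R a))) z \<le> 1"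
proof -
  have ab: "norm (a + b) \<le> 2" using norm_triangle_ineq[of a b] norms by simp
  obtain z where z: "norm z = 1" "norm (act (a + b) z) = 2"
    "act (a + b) z \<bullet> act (exp (T *\<^sub>R a) * E * exp (- (T *\<^sub>R a))) z \<le> 2"
  proof (rule norm_attaining_direction[OF ab E])
    show "2 \<le> norm c + norm d"
      if "c + exp (T *\<^sub>R a) * d * exp (- (T *\<^sub>R a)) = a + b" for c d
      using that by (rule exp_minimal_first_variation[OF min norms s T])
  qed
  have le: "norm (act a z) \<le> 1" "norm (act b z) \<le> 1"
    using norm_act_le[of a z] norm_act_le[of b z] norms z(1) by auto
  have "4 = (norm (act a z + act b z))\<^sup>2" using z(2) unfolding act_plus by simp
  also have "\<dots> = (norm (act a z))\<^sup>2 + (norm (act b z))\<^sup>2 + 2 * (act a z \<bullet> act b z)"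
    unfolding power2_norm_eq_inner inner_add_left inner_add_right
    using inner_commute[of "act b z" "act a z"] by simp
  also have "\<dots> \<le> 1 + 1 + 2 * (act a z \<bullet> act b z)"
    using le by (intro add_mono power_le_one) auto
  finally have "1 \<le> act a z \<bullet> act b z" by simp
  moreover have "act a z \<bullet> act b z \<le> 1"
    using norm_cauchy_schwarz[of "act a z" "act b z"] mult_le_one[OF le(1) norm_ge_zero le(2)]
    by linarith
  ultimately have eq: "act a z = act b z" using inner_eq_norms_imp_eq[OF le] by linarith
  have sum: "act (a + b) z = 2 *\<^sub>R act a z" unfolding scaleR_2 act_plus eq ..
  show thesis
  proof (rule that[OF z(1) eq])
    show "norm (act a z) = 1" using z(2) unfolding sum by simp
    show "act a z \<bullet> act (exp (T *\<^sub>R a) * E * exp (- (T *\<^sub>R a))) z \<le> 1"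
      using z(3) unfolding sum inner_scaleR_left by simp
  qed
qed

section \<open>Conjugation and rank one operators\<close>

text \<open>Polarization: the sort relates the inner product to multiplication only through the
  norm, which is multiplicative.\<close>

lemma inner_mult_mult:
  fixes c x y :: "'a::{real_normed_field,real_inner}"
  shows "(c * x) \<bullet> (c * y) = (norm c)\<^sup>2 * (x \<bullet> y)"
proof -
  have "4 * ((c * x) \<bullet> (c * y)) = (norm (c * (x + y)))\<^sup>2 - (norm (c * (x - y)))\<^sup>2"
    unfolding power2_norm_eq_inner by (simp add: algebra_simps inner_commute)
  also have "\<dots> = (norm c)\<^sup>2 * ((norm (x + y))\<^sup>2 - (norm (x - y))\<^sup>2)"
    unfolding norm_mult power_mult_distrib by (simp add: right_diff_distrib)
  also have "(norm (x + y))\<^sup>2 - (norm (x - y))\<^sup>2 = 4 * (x \<bullet> y)"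
    unfolding power2_norm_eq_inner by (simp add: algebra_simps inner_commute)
  finally show ?thesis by simp
qed

lemma inner_vector_scalar:
  fixes x y :: "'a::{real_normed_field,real_inner}^'n"
  shows "(c *s x) \<bullet> (c *s y) = (norm c)\<^sup>2 * (x \<bullet> y)"
  by (simp add: inner_vec_def inner_mult_mult sum_distrib_left)

text \<open>In any real normed field with a compatible inner product this is the conjugation: the
  identity on the reals and \<open>cnj\<close> on the complex numbers. At \<open>0\<close> the division by zero gives \<open>0\<close>.\<close>

definition conjg :: "'a::real_normed_field \<Rightarrow> 'a" where
  "conjg a = of_real ((norm a)\<^sup>2) / a"

lemma conjg_mult_self [simp]: "conjg a * a = of_real ((norm a)\<^sup>2)" "a * conjg a = of_real ((norm a)\<^sup>2)"
  by (simp_all add: conjg_def)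

lemma norm_conjg [simp]: "norm (conjg a) = norm a"
  unfolding conjg_def norm_divide norm_of_real by (simp add: power2_eq_square)

lemma conjg_mult: "conjg (a * b) = conjg a * conjg b"
  by (simp add: conjg_def norm_mult power_mult_distrib)

lemma conjg_eq_0_iff [simp]: "conjg a = 0 \<longleftrightarrow> a = 0"
  by (simp add: conjg_def)

definition rank_one :: "'a^'n \<Rightarrow> 'a^'n \<Rightarrow> ('a::{real_normed_field,euclidean_space}, 'n::finite) sqmat" where
  "rank_one y x = to_sqmat (\<chi> i j. y $ i * conjg (x $ j))"

lemma act_rank_one: "act (rank_one y x) z = (\<Sum>j\<in>UNIV. conjg (x $ j) * z $ j) *s y"
  by (simp add: rank_one_def act.rep_eq matrix_vector_mult_def vec_eq_iff sum_distrib_left mult_ac)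

lemma act_rank_one_self: "act (rank_one y x) x = (norm x)\<^sup>2 *\<^sub>R y"
proof -
  have "(\<Sum>j\<in>UNIV. conjg (x $ j) * x $ j) = of_real ((norm x)\<^sup>2)"
    by (simp add: norm_vec_def L2_set_def sum_nonneg)
  then show ?thesis
    unfolding act_rank_one by (simp add: vec_eq_iff scaleR_conv_of_real[where 'a = 'a])
qed

lemma norm_rank_one_le: "norm (rank_one y x) \<le> norm x * norm y"
proof (rule norm_sqmat_le)
  fix z
  have "norm (\<Sum>j\<in>UNIV. conjg (x $ j) * z $ j) \<le> (\<Sum>j\<in>UNIV. \<bar>norm (x $ j)\<bar> * \<bar>norm (z $ j)\<bar>)"
    by (rule order_trans[OF norm_sum]) (simp add: norm_mult)
  also have "\<dots> \<le> norm x * norm z"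
    unfolding norm_vec_def by (rule L2_set_mult_ineq)
  finally have "norm (act (rank_one y x) z) \<le> norm x * norm z * norm y"
    unfolding act_rank_one norm_vector_scalar by (rule mult_right_mono) simp
  then show "norm (act (rank_one y x) z) \<le> norm x * norm y * norm z" by (simp add: mult_ac)
qed

text \<open>Let \<open>y\<close> be the adjoint of \<open>P\<close> applied to \<open>v\<close>. As
  \<open>P\<close> commutes with \<open>a\<close>, \<open>y \<bullet> act a x = 1\<close>. Moreover
  \<open>norm (act a x) \<le> norm x\<close>, and a suitable \<open>E\<close> gives
  \<open>norm x * norm y \<le> 1\<close>. So Cauchy-Schwarz is an equality, and
  \<open>act a x = (norm x)\<^sup>2 *\<^sub>R y\<close>.\<close>

lemma exp_minimal_transport:
  assumes min: "exp_minimal [t *\<^sub>R a, s *\<^sub>R b]" and norms: "norm a = 1" "norm b = 1"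
    and s: "s > 0" and T: "0 < T" "T < t"
    and u: "norm u = 1" "act a u = act b u" "norm (act a u) = 1"
    and unique: "\<And>z. norm z = 1 \<Longrightarrow> act a z = act b z \<Longrightarrow> norm (act a z) = 1 \<Longrightarrow>
      \<exists>\<theta>. norm \<theta> = 1 \<and> z = \<theta> *s u"
  defines "x \<equiv> act (exp (- (T *\<^sub>R a))) u"
  shows "act a x \<bullet> w = (x \<bullet> x) * (act a u \<bullet> act (exp (T *\<^sub>R a)) w)"
proof -
  define P Q where "P = exp (T *\<^sub>R a)" and "Q = exp (- (T *\<^sub>R a))"
  define v where "v = act a u"
  have lin: "linear (act P)" using act_bounded_linear by (rule bounded_linear.linear)
  define y where "y = adjoint (act P) v"
  have y: "y \<bullet> z = v \<bullet> act P z" for z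
    unfolding y_def using adjoint_works[OF lin] by (simp add: inner_commute)
  have "P * a = a * P" unfolding P_def by (rule exp_times_scaleR_commute)
  moreover have "P * Q = 1" unfolding P_def Q_def by (rule exp_minus_inverse)
  ultimately have "P * a * Q = a" by (simp add: mult.assoc)
  moreover have "act P (act a x) = act (P * a * Q) u" by (simp add: x_def Q_def)
  ultimately have "act P (act a x) = v" by (simp add: v_def)
  then have yax: "y \<bullet> act a x = 1" using u(3) y by (simp add: v_def dot_square_norm)
  have ax: "norm (act a x) \<le> norm x" using norms by (simp add: norm_act_le_1)
  have nz: "norm x > 0" "norm y > 0" using yax by auto
  \<comment> \<open>Among operators of norm at most 1 this choice makes
    \<open>v \<bullet> act P (act E x) = y \<bullet> act E x\<close> largest: it sends
    \<open>x\<close> to the positive multiple of \<open>y\<close> of norm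
    \<open>norm x\<close>.\<close>
  define E where "E = (1 / (norm x * norm y)) *\<^sub>R rank_one y x"
  have "norm E \<le> 1"
    using norm_rank_one_le[of y x] nz by (simp add: E_def)
  then obtain z where z: "norm z = 1" "act a z = act b z" "norm (act a z) = 1"
      "act a z \<bullet> act (P * E * Q) z \<le> 1"
    unfolding P_def Q_def by (rule exp_minimal_common_direction[OF min norms s T])
  \<comment> \<open>The vector \<open>z\<close> depends on \<open>E\<close>; uniqueness replaces it
    by \<open>u\<close> up to a phase, which drops out of the inner product.\<close>
  then obtain \<theta> where \<theta>: "norm \<theta> = 1" "z = \<theta> *s u" using unique by blast
  have "v \<bullet> act P (act E x) \<le> 1"
    using z(4) unfolding \<theta>(2) act_vector_scalar inner_vector_scalar
    by (simp add: \<theta>(1) v_def x_def Q_def)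
  moreover have "act E x = (norm x / norm y) *\<^sub>R y"
    using nz by (simp add: E_def act_rank_one_self power2_eq_square)
  ultimately have "norm x / norm y * (y \<bullet> y) \<le> 1" by (simp add: y[symmetric])
  then have xy: "norm x * norm y \<le> 1"
    using nz by (simp add: dot_square_norm power2_eq_square)
  have "act a x = (norm x)\<^sup>2 *\<^sub>R y"
  proof -
    have "norm ((1 / norm x) *\<^sub>R act a x) \<le> 1" "norm (norm x *\<^sub>R y) \<le> 1"
      "((1 / norm x) *\<^sub>R act a x) \<bullet> (norm x *\<^sub>R y) = 1"
      using ax nz xy yax by (simp_all add: inner_commute)
    then have "(1 / norm x) *\<^sub>R act a x = norm x *\<^sub>R y" by (rule inner_eq_norms_imp_eq)
    then have "norm x *\<^sub>R (1 / norm x) *\<^sub>R act a x = norm x *\<^sub>R norm x *\<^sub>R y" by simp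
    then show ?thesis using nz by (simp add: power2_eq_square)
  qed
  then show ?thesis using y[of w] by (simp add: dot_square_norm v_def P_def)
qed

text \<open>The transport identity holds for \<open>0 < T\<close> and \<open>T < t\<close>, so its
  derivative at 0 is read off from right-hand difference quotients.\<close>

lemma derivative_eq_0_of_vanishing_right:
  fixes f :: "real \<Rightarrow> real"
  assumes "(f has_real_derivative D) (at 0)" "f 0 = 0" "t > 0" "\<And>h. 0 < h \<Longrightarrow> h < t \<Longrightarrow> f h = 0"
  shows "D = 0"
proof -
  have "((\<lambda>h. f h / h) \<longlongrightarrow> D) (at_right 0)"
    using assms(1,2) by (intro filterlim_mono[OF _ order_refl at_le[of "{0<..}" UNIV 0]])
      (auto simp: DERIV_def)
  moreover have "((\<lambda>h. f h / h) \<longlongrightarrow> 0) (at_right 0)"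
    using assms(3,4)
    by (intro tendsto_eventually) (auto simp: eventually_at_right_field)
  ultimately show ?thesis by (rule tendsto_unique[OF trivial_limit_at_right_real])
qed

text \<open>The derivative of the transport identity at \<open>T = 0\<close>. Differentiating
  \<open>x \<bullet> x\<close> produces the factor \<open>2 * (u \<bullet> v)\<close>, and the
  remaining term \<open>v \<bullet> act a w\<close> is \<open>u \<bullet> w\<close> because
  \<open>a\<close> keeps the norm of \<open>u\<close>.\<close>

lemma exp_minimal_second_image:
  assumes min: "exp_minimal [t *\<^sub>R a, s *\<^sub>R b]" and norms: "norm a = 1" "norm b = 1"
    and ts: "t > 0" "s > 0"
    and u: "norm u = 1" "act a u = act b u" "norm (act a u) = 1"
    and unique: "\<And>z. norm z = 1 \<Longrightarrow> act a z = act b z \<Longrightarrow> norm (act a z) = 1 \<Longrightarrow>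
      \<exists>\<theta>. norm \<theta> = 1 \<and> z = \<theta> *s u"
  shows "act a (act a u) = (2 * (u \<bullet> act a u)) *\<^sub>R act a u - u"
proof -
  define v where "v = act a u"
  define x where "x h = act (exp (h *\<^sub>R - a)) u" for h
  have der: "((\<lambda>h. act (exp (h *\<^sub>R c)) w) has_vector_derivative act c w) (at 0)" for c w
    using bounded_linear.has_vector_derivative[OF bounded_linear_act_left[of w]
        exp_scaleR_has_vector_derivative_right[of c 0 UNIV]]
    by simp
  have dx: "(x has_vector_derivative - v) (at 0)"
    using der[of "- a" u] by (simp add: x_def[abs_def] v_def)
  have x0: "x 0 = u" by (simp add: x_def)
  have "act a v \<bullet> w = (2 * (u \<bullet> v)) * (v \<bullet> w) - u \<bullet> w" for w
  proof -
    define f where "f h = act a (x h) \<bullet> w - (x h \<bullet> x h) * (v \<bullet> act (exp (h *\<^sub>R a)) w)" for h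
    have d1: "((\<lambda>h. act a (x h) \<bullet> w) has_real_derivative act a (- v) \<bullet> w) (at 0)"
      unfolding has_real_derivative_iff_has_vector_derivative
      by (intro bounded_linear.has_vector_derivative[OF bounded_linear_inner_left]
        bounded_linear.has_vector_derivative[OF act_bounded_linear] dx)
    have d2: "((\<lambda>h. x h \<bullet> x h) has_real_derivative (x 0 \<bullet> (- v) + (- v) \<bullet> x 0)) (at 0)"
      unfolding has_real_derivative_iff_has_vector_derivative
      by (rule bounded_bilinear.has_vector_derivative[OF bounded_bilinear_inner dx dx])
    have d3: "((\<lambda>h. v \<bullet> act (exp (h *\<^sub>R a)) w) has_real_derivative v \<bullet> act a w) (at 0)"
      unfolding has_real_derivative_iff_has_vector_derivative
      by (rule bounded_linear.has_vector_derivative[OF bounded_linear_inner_right der])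
    have uu: "u \<bullet> u = 1" using u(1) by (simp add: dot_square_norm)
    have va: "v \<bullet> act a w = u \<bullet> w"
      unfolding v_def by (rule norm_attaining_adjoint) (use norms u in auto)
    have "(f has_real_derivative (- (act a v \<bullet> w) + 2 * (u \<bullet> v) * (v \<bullet> w) - u \<bullet> w)) (at 0)"
      unfolding f_def
      by (rule DERIV_cong[OF DERIV_diff[OF d1 DERIV_mult[OF d2 d3]]])
        (use va uu inner_commute[of v u] in \<open>simp add: x0\<close>)
    moreover have "f h = 0" if "0 < h" "h < t" for h
    proof -
      define q where "q = act (exp (- (h *\<^sub>R a))) u"
      have "act a q \<bullet> w = (q \<bullet> q) * (act a u \<bullet> act (exp (h *\<^sub>R a)) w)"
        unfolding q_def
        by (rule exp_minimal_transport[OF min norms ts(2) that u]) (erule (2) unique)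
      then show ?thesis by (simp add: f_def x_def v_def q_def)
    qed
    moreover have "f 0 = 0" using u(1) by (simp add: f_def x0 v_def dot_square_norm)
    ultimately have "- (act a v \<bullet> w) + 2 * (u \<bullet> v) * (v \<bullet> w) - u \<bullet> w = 0"
      using derivative_eq_0_of_vanishing_right[of f _ t] ts(1) by blast
    then show ?thesis by simp
  qed
  then have "\<forall>w. act a v \<bullet> w = ((2 * (u \<bullet> v)) *\<^sub>R v - u) \<bullet> w"
    by (simp add: inner_diff_left)
  then show ?thesis unfolding v_def[symmetric] using vector_eq_rdot by blast
qed

section \<open>Two-by-two matrices\<close>

lemma cramer_2:
  fixes u z w :: "'a::field^2"
  assumes "u $ 1 * z $ 2 \<noteq> u $ 2 * z $ 1"
  obtains \<alpha> \<beta> where "w = \<alpha> *s u + \<beta> *s z"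
proof
  let ?d = "u $ 1 * z $ 2 - u $ 2 * z $ 1"
  have d: "?d \<noteq> 0" using assms by simp
  have "w $ i * ?d = (w $ 1 * z $ 2 - w $ 2 * z $ 1) * u $ i + (u $ 1 * w $ 2 - u $ 2 * w $ 1) * z $ i" for i
    using exhaust_2[of i] by (auto simp: algebra_simps)
  then have eq: "w $ i = ((w $ 1 * z $ 2 - w $ 2 * z $ 1) * u $ i + (u $ 1 * w $ 2 - u $ 2 * w $ 1) * z $ i) / ?d" for i
    by (rule iffD2[OF nonzero_eq_divide_eq[OF d]])
  show "w = ((w $ 1 * z $ 2 - w $ 2 * z $ 1) / ?d) *s u + ((u $ 1 * w $ 2 - u $ 2 * w $ 1) / ?d) *s z"
    unfolding vec_eq_iff by (intro allI, subst eq) (simp add: add_divide_distrib)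
qed

lemma dependent_2:
  fixes u z :: "'a::field^2"
  assumes "u $ 1 * z $ 2 = u $ 2 * z $ 1" "u \<noteq> 0"
  obtains \<theta> where "z = \<theta> *s u"
proof (cases "u $ 1 = 0")
  case True
  then have "u $ 2 \<noteq> 0" using assms(2) by (auto simp: vec_eq_iff forall_2)
  then show thesis using assms(1) True by (intro that[of "z $ 2 / u $ 2"]) (auto simp: vec_eq_iff forall_2)
next
  case False
  then show thesis using assms(1)
    by (intro that[of "z $ 1 / u $ 1"]) (auto simp: vec_eq_iff forall_2 field_simps)
qed

text \<open>If \<open>u\<close> is unique up to a phase, then \<open>act a u\<close> meets the same
  three conditions and is a multiple of \<open>u\<close>. Otherwise there is a second, independent
  such vector, and the two span the plane.\<close>

lemma exp_minimal_eigenvector_or_isometry: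
  fixes a b :: "('a::{real_normed_field,euclidean_space}, 2) sqmat"
  assumes min: "exp_minimal [t *\<^sub>R a, s *\<^sub>R b]" and norms: "norm a = 1" "norm b = 1"
    and ts: "t > 0" "s > 0"
    and u: "norm u = 1" "act a u = act b u" "norm (act a u) = 1"
  shows "(\<exists>\<theta>. norm \<theta> = 1 \<and> act a u = \<theta> *s u) \<or> (a = b \<and> (\<forall>w. norm (act a w) = norm w))"
proof (cases "\<forall>z. norm z = 1 \<longrightarrow> act a z = act b z \<longrightarrow> norm (act a z) = 1 \<longrightarrow>
    (\<exists>\<theta>. norm \<theta> = 1 \<and> z = \<theta> *s u)")
  case True
  define v where "v = act a u"
  have vv: "v \<bullet> v = 1" and uu: "u \<bullet> u = 1" using u by (simp_all add: v_def dot_square_norm)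
  have a: "act a v = (2 * (u \<bullet> v)) *\<^sub>R v - u"
    unfolding v_def by (rule exp_minimal_second_image[OF min norms ts u]) (use True in blast)
  \<comment> \<open>Time reversal puts \<open>- b\<close> in the place of \<open>a\<close>; the
    signs cancel in the formula for the second image, which thus holds for \<open>b\<close>
    itself.\<close>
  have rev: "exp_minimal [s *\<^sub>R - b, t *\<^sub>R - a]"
    using exp_minimal_uminus_rev[OF min] by simp
  have "act (- b) (act (- b) u) = (2 * (u \<bullet> act (- b) u)) *\<^sub>R act (- b) u - u"
    by (rule exp_minimal_second_image[OF rev _ _ ts(2,1)]) (use norms u True in auto)
  then have b: "act b v = (2 * (u \<bullet> v)) *\<^sub>R v - u"
    using u(2) by (simp add: v_def)
  \<comment> \<open>The right-hand side of \<open>a\<close> is the reflection of \<open>u\<close> in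
    the line through \<open>v\<close>, hence a unit vector.\<close>
  have "act a v \<bullet> act a v = 1"
    unfolding a using vv uu by (simp add: inner_diff_left inner_diff_right inner_commute)
  then have "norm (act a v) = 1" by (simp add: norm_eq_1)
  moreover have "act a v = act b v" using a b by simp
  moreover have "norm v = 1" using u(3) by (simp add: v_def)
  ultimately obtain \<theta> where "norm \<theta> = 1" "v = \<theta> *s u" using True by blast
  then show ?thesis unfolding v_def by blast
next
  case False
  then obtain z where z: "norm z = 1" "act a z = act b z" "norm (act a z) = 1"
    "\<And>\<theta>. norm \<theta> = 1 \<Longrightarrow> z \<noteq> \<theta> *s u" by blast
  have indep: "u $ 1 * z $ 2 \<noteq> u $ 2 * z $ 1"
  proof
    assume "u $ 1 * z $ 2 = u $ 2 * z $ 1"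
    moreover have "u \<noteq> 0" using u(1) by auto
    ultimately obtain \<theta> where "z = \<theta> *s u" by (rule dependent_2)
    moreover from this have "norm \<theta> = 1" using z(1) u(1) by (simp add: norm_vector_scalar)
    ultimately show False using z(4) by blast
  qed
  have "a = b"
  proof (rule sqmat_eqI)
    fix w
    obtain \<alpha> \<beta> where "w = \<alpha> *s u + \<beta> *s z" using indep by (rule cramer_2)
    then show "act a w = act b w" using u(2) z(2) by simp
  qed
  moreover have "norm (act a w) = norm w" for w
  proof -
    obtain \<alpha> \<beta> where w: "w = \<alpha> *s u + \<beta> *s z" using indep by (rule cramer_2)
    \<comment> \<open>The inner product is only real bilinear, so field scalars cannot be pulled
      out; the adjoint identity is applied to the multiples themselves, whose norms \<open>a\<close>
      also keeps.\<close>
    have "act a (\<alpha> *s u) \<bullet> act a w = (\<alpha> *s u) \<bullet> w" "act a (\<beta> *s z) \<bullet> act a w = (\<beta> *s z) \<bullet> w"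
      by (rule norm_attaining_adjoint; use norms(1) u(1,3) z(1,3) in \<open>simp add: norm_vector_scalar\<close>)+
    then have "act a w \<bullet> act a w = w \<bullet> w"
      by (subst (1 3) w) (simp add: inner_add_left)
    then show ?thesis by (simp add: norm_eq)
  qed
  ultimately show ?thesis by blast
qed

section \<open>Diagonal form in a unitary frame\<close>

lemma inner_conjg: "a \<bullet> b = 1 \<bullet> (conjg a * b)"
  for a b :: "'a::{real_normed_field,euclidean_space}"
proof (cases "a = 0")
  case False
  have "a \<bullet> b = (a * 1) \<bullet> (a * (b / a))" using False by simp
  also have "\<dots> = 1 \<bullet> ((norm a)\<^sup>2 *\<^sub>R (b / a))" unfolding inner_mult_mult by simp
  also have "(norm a)\<^sup>2 *\<^sub>R (b / a) = conjg a * b"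
    by (simp add: conjg_def scaleR_conv_of_real)
  finally show ?thesis .
qed (simp add: conjg_def)

text \<open>Over \<open>complex\<close>, taking the inner product with 1 gives the real part, so
  this presents the real inner product as the real part of the Hermitian one.\<close>

lemma inner_vec_2: "x \<bullet> y = 1 \<bullet> (conjg (x $ 1) * y $ 1 + conjg (x $ 2) * y $ 2)"
  for x y :: "'a::{real_normed_field,euclidean_space}^2"
  by (simp add: inner_vec_def sum_2 inner_add_right inner_conjg[of "x $ _"])

text \<open>For a unit vector \<open>u\<close> these are the unitary matrix whose first row is the adjoint of \<open>u\<close>, and its inverse.\<close>

definition frame :: "'a::real_normed_field^2 \<Rightarrow> 'a^2^2" where
  "frame u = (\<chi> i j. if i = 1 then conjg (u $ j) else if j = 1 then - u $ 2 else u $ 1)"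

definition coframe :: "'a::real_normed_field^2 \<Rightarrow> 'a^2^2" where
  "coframe u = (\<chi> i j. if j = 1 then u $ i else if i = 1 then - conjg (u $ 2) else conjg (u $ 1))"

lemma frame_coframe:
  assumes "norm u = 1"
  shows "frame u ** coframe u = mat 1" "coframe u ** frame u = mat 1"
proof -
  have "(norm (u $ 1))\<^sup>2 + (norm (u $ 2))\<^sup>2 = 1"
    using assms by (simp add: norm_vec_def L2_set_def sum_2)
  then have "(of_real ((norm (u $ 1))\<^sup>2) + of_real ((norm (u $ 2))\<^sup>2) :: 'a) = 1"
    by (metis of_real_1 of_real_add)
  then show "frame u ** coframe u = mat 1"
    by (simp add: vec_eq_iff forall_2 matrix_matrix_mult_def sum_2 frame_def coframe_def mat_def
        add.commute mult.commute del: of_real_power)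
  then show "coframe u ** frame u = mat 1" by (simp add: matrix_left_right_inverse)
qed

lemma matrix_inv_frame:
  fixes u :: "'a::real_normed_field^2"
  assumes "norm u = 1"
  shows "matrix_inv (frame u) = coframe u"
proof -
  have "\<exists>M. frame u ** M = mat 1 \<and> M ** frame u = mat 1"
    using frame_coframe[OF assms] by blast
  then have "matrix_inv (frame u) ** frame u = mat 1"
    unfolding matrix_inv_def by (rule someI2_ex) simp
  then have "matrix_inv (frame u) ** frame u ** coframe u = coframe u" by simp
  then show ?thesis
    by (simp add: frame_coframe[OF assms] flip: matrix_mul_assoc)
qed

text \<open>As \<open>A\<close> keeps the norm of \<open>u\<close>, it maps vectors orthogonal to
  \<open>u\<close> to vectors orthogonal to \<open>act A u\<close>, hence to \<open>u\<close>: the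
  upper right entry vanishes. The lower left one vanishes by \<open>eig\<close>.\<close>

lemma diag_in_frame:
  fixes A :: "('a::{real_normed_field,euclidean_space}, 2) sqmat"
  assumes A: "norm A \<le> 1" and u: "norm u = 1" and \<theta>: "norm \<theta> = 1" and eig: "act A u = \<theta> *s u"
  obtains l where "frame u ** of_sqmat A ** coframe u = diag2 \<theta> l"
proof -
  \<comment> \<open>The second column of \<open>coframe u\<close>, orthogonal to \<open>u\<close>;
    the number \<open>c\<close> below is then the upper right entry of the conjugated
    matrix.\<close>
  define p where "p = (\<chi> i. if i = 1 then - conjg (u $ 2) else conjg (u $ (1::2)) :: 'a^2)"
  define c where "c = conjg (u $ 1) * act A p $ 1 + conjg (u $ 2) * act A p $ 2"
  have unit: "conjg (u $ 1) * u $ 1 + conjg (u $ 2) * u $ 2 = 1"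
    using arg_cong[OF frame_coframe(1)[OF u], of "\<lambda>M. M $ 1 $ 1"]
    by (simp add: matrix_matrix_mult_def sum_2 frame_def coframe_def mat_def)
  have "c = 0"
  proof (rule ccontr)
    assume c: "c \<noteq> 0"
    have nz: "conjg \<theta> \<noteq> 0" using \<theta> by auto
    \<comment> \<open>The inner product only controls a real part. Scaling \<open>p\<close> by
      \<open>\<tau>\<close> turns the number in question into 1, whose real part is not 0.\<close>
    define \<tau> where "\<tau> = inverse (conjg \<theta> * c)"
    have "act A u \<bullet> act A (\<tau> *s p) = u \<bullet> (\<tau> *s p)"
      by (rule norm_attaining_adjoint[OF A]) (simp add: eig \<theta> norm_vector_scalar)
    also have "\<dots> = 0" unfolding inner_vec_2[of u] by (simp add: p_def)
    finally have "1 \<bullet> (conjg \<theta> * \<tau> * c) = (0::real)"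
      unfolding eig act_vector_scalar inner_vec_2[of "\<theta> *s u"]
      by (simp add: conjg_mult c_def algebra_simps)
    moreover have "conjg \<theta> * \<tau> * c = 1" using nz c by (simp add: \<tau>_def field_simps)
    ultimately show False by (simp add: dot_square_norm)
  qed
  define M where "M = frame u ** of_sqmat A ** coframe u"
  have M: "M = frame u ** (of_sqmat A ** coframe u)" unfolding M_def by (simp add: matrix_mul_assoc)
  have col1: "(of_sqmat A ** coframe u) $ i $ 1 = \<theta> * u $ i" for i
    using arg_cong[OF eig, of "\<lambda>x. x $ i"]
    by (simp add: act.rep_eq matrix_matrix_mult_def matrix_vector_mult_def coframe_def)
  have col2: "(of_sqmat A ** coframe u) $ i $ 2 = act A p $ i" for i
    by (simp add: act.rep_eq matrix_matrix_mult_def matrix_vector_mult_def coframe_def p_def)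
  have "M = diag2 \<theta> (M $ 2 $ 2)"
    using unit \<open>c = 0\<close> unfolding M matrix_matrix_mult_def[of "frame u"]
    by (simp add: vec_eq_iff forall_2 sum_2 col1 col2 frame_def diag2_def c_def)
      (simp add: algebra_simps flip: distrib_left)
  then show thesis using that unfolding M_def by blast
qed

lemma diag2_commute: "diag2 a b ** diag2 c d = diag2 c d ** diag2 a (b::'a::field)"
  by (simp add: vec_eq_iff forall_2 matrix_matrix_mult_def sum_2 diag2_def)

lemma matrix_conj_mult:
  fixes F C A B :: "'a::field^'n^'n"
  assumes "C ** F = mat 1"
  shows "(F ** A ** C) ** (F ** B ** C) = F ** (A ** B) ** C"
proof -
  have "(F ** A ** C) ** (F ** B ** C) = F ** A ** (C ** F) ** B ** C" by (simp add: matrix_mul_assoc)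
  then show ?thesis by (simp add: assms matrix_mul_assoc)
qed

lemma matrix_conj_cancel:
  fixes F C A :: "'a::field^'n^'n"
  assumes "C ** F = mat 1"
  shows "C ** (F ** A ** C) ** F = A"
proof -
  have "C ** (F ** A ** C) ** F = (C ** F) ** A ** (C ** F)" by (simp add: matrix_mul_assoc)
  then show ?thesis by (simp add: assms)
qed

text \<open>A common eigenvector makes both normalized matrices diagonal in one frame; in the
  isometry case they are equal.\<close>

lemma exp_minimal_commute:
  fixes x y :: "('a::{real_normed_field,euclidean_space}, 2) sqmat"
  assumes min: "exp_minimal [x, y]"
  shows "x * y = y * x"
proof (cases "x = 0 \<or> y = 0")
  case False
  obtain t a where a: "t > 0" "norm a = 1" "x = t *\<^sub>R a"
    by (rule that[of "norm x" "x /\<^sub>R norm x"]) (use False in auto)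
  obtain r b where b: "r > 0" "norm b = 1" "y = r *\<^sub>R b"
    by (rule that[of "norm y" "y /\<^sub>R norm y"]) (use False in auto)
  have min': "exp_minimal [t *\<^sub>R a, r *\<^sub>R b]" using min a(3) b(3) by simp
  \<comment> \<open>Only the common vector \<open>u\<close> is wanted here, so \<open>T\<close> is
    the midpoint and \<open>E\<close> is 0.\<close>
  have T: "0 < t / 2" "t / 2 < t" using a(1) by auto
  obtain u where u: "norm u = 1" "act a u = act b u" "norm (act a u) = 1"
    by (rule exp_minimal_common_direction[OF min' a(2) b(2) b(1) T, of 0]) auto
  have "a * b = b * a"
    using exp_minimal_eigenvector_or_isometry[OF min' a(2) b(2) a(1) b(1) u]
  proof
    assume "\<exists>\<theta>. norm \<theta> = 1 \<and> act a u = \<theta> *s u"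
    then obtain \<theta> where \<theta>: "norm \<theta> = 1" "act a u = \<theta> *s u" "act b u = \<theta> *s u" using u(2) by auto
    let ?F = "frame u" and ?C = "coframe u"
    obtain l where l: "?F ** of_sqmat a ** ?C = diag2 \<theta> l"
      by (rule diag_in_frame[OF _ u(1) \<theta>(1,2)]) (use a in auto)
    obtain m where m: "?F ** of_sqmat b ** ?C = diag2 \<theta> m"
      by (rule diag_in_frame[OF _ u(1) \<theta>(1,3)]) (use b in auto)
    note inv = frame_coframe[OF u(1)]
    have "?F ** of_sqmat (a * b) ** ?C = ?F ** of_sqmat (b * a) ** ?C"
      unfolding times_sqmat.rep_eq matrix_conj_mult[OF inv(2), symmetric] l m by (rule diag2_commute)
    then have "of_sqmat (a * b) = of_sqmat (b * a)"
      using matrix_conj_cancel[OF inv(2)] by metis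
    then show ?thesis by (simp add: of_sqmat_inject)
  qed simp
  then show ?thesis using a(3) b(3) by simp
qed auto

text \<open>The norms of the commuting exponents add up. At a unit vector \<open>u\<close> where
  their sum \<open>X\<close> attains its norm the triangle inequality is an equality, so every
  \<open>B i\<close> sends this one \<open>u\<close> to the same unit vector
  \<open>v\<close>.\<close>

lemma exp_minimal_common_eigenvector_or_isometry:
  fixes B :: "nat \<Rightarrow> ('a::{real_normed_field,euclidean_space}, 2) sqmat"
  assumes k: "k \<ge> 1" and s: "\<And>i. i \<in> {1..k} \<Longrightarrow> s i > 0" and B: "\<And>i. i \<in> {1..k} \<Longrightarrow> norm (B i) = 1"
    and min: "exp_minimal (map (\<lambda>i. s i *\<^sub>R B i) [1..<k+1])"
  shows "(\<exists>u \<theta>. norm u = 1 \<and> norm \<theta> = 1 \<and> (\<forall>i\<in>{1..k}. act (B i) u = \<theta> *s u)) \<or>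
    ((\<forall>i\<in>{1..k}. B i = B 1) \<and> (\<forall>w. norm (act (B 1) w) = norm w))"
proof -
  let ?I = "{1..k}" and ?xs = "map (\<lambda>i. s i *\<^sub>R B i) [1..<k+1]"
  define X where "X = (\<Sum>i\<in>?I. s i *\<^sub>R B i)"
  have set: "set [1..<k+1] = ?I" by auto
  have "sum_list ?xs = X"
    unfolding X_def interv_sum_list_conv_sum_set_nat set ..
  moreover have "sum_list (map norm ?xs) = (\<Sum>i\<in>?I. s i)"
    unfolding map_map interv_sum_list_conv_sum_set_nat set using s B by (intro sum.cong) (auto intro!: abs_of_pos)
  ultimately have X: "(\<Sum>i\<in>?I. s i) \<le> norm X"
    using exp_minimal_norm_sum_list[OF exp_minimal_commute min] by simp
  obtain u where u: "norm u = 1" "norm (act X u) = norm X" using exists_norm_attained by blast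
  define v where "v = act X u /\<^sub>R norm (act X u)"
  have "0 < (\<Sum>i\<in>?I. s i)" using k s by (intro sum_pos) auto
  then have nX: "norm (act X u) > 0" using X u(2) by linarith
  then have v: "norm v = 1" by (simp add: v_def)
  have actX: "act X u = (\<Sum>i\<in>?I. s i *\<^sub>R act (B i) u)"
    unfolding X_def by (simp add: bounded_linear.linear linear_sum[OF bounded_linear.linear[OF bounded_linear_act_left]])
  have le: "norm (act (B i) u) \<le> 1" if "i \<in> ?I" for i
    using norm_act_le_1[of "B i" u] B that u(1) by simp
  then have le': "act (B i) u \<bullet> v \<le> 1" if "i \<in> ?I" for i
    using norm_cauchy_schwarz[of "act (B i) u" v] that v by fastforce
  have "(\<Sum>i\<in>?I. s i * (act (B i) u \<bullet> v)) = act X u \<bullet> v"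
    by (simp add: actX inner_sum_left)
  also have "\<dots> = norm X" using nX u(2) by (simp add: v_def dot_square_norm power2_eq_square)
  \<comment> \<open>Every summand is nonnegative, so each vanishes.\<close>
  finally have "(\<Sum>i\<in>?I. s i * (1 - act (B i) u \<bullet> v)) \<le> 0"
    using X by (simp add: right_diff_distrib sum_subtractf)
  moreover have nonneg: "s i * (1 - act (B i) u \<bullet> v) \<ge> 0" if "i \<in> ?I" for i
    using s[OF that] le'[OF that] by simp
  ultimately have "\<forall>i\<in>?I. s i * (1 - act (B i) u \<bullet> v) = 0"
    using sum_nonneg_eq_0_iff[of ?I "\<lambda>i. s i * (1 - act (B i) u \<bullet> v)"]
      sum_nonneg[of ?I "\<lambda>i. s i * (1 - act (B i) u \<bullet> v)"] by auto
  then have zero: "s i * (1 - act (B i) u \<bullet> v) = 0" if "i \<in> ?I" for i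
    using that by blast
  have Bu: "act (B i) u = v" if "i \<in> ?I" for i
  proof (rule inner_eq_norms_imp_eq[OF le[OF that]])
    show "norm v \<le> 1" using v by simp
    show "act (B i) u \<bullet> v = 1" using zero[OF that] s[OF that] by simp
  qed
  show ?thesis
  proof (cases "\<exists>\<theta>. norm \<theta> = 1 \<and> v = \<theta> *s u")
    case True
    then show ?thesis using Bu u(1) by metis
  next
    case False
    \<comment> \<open>Since \<open>v\<close> is no phase multiple of \<open>u\<close>, the dichotomy
      at this \<open>u\<close> leaves only the isometry case for each minimal pair.\<close>
    have pair: "B i = B j \<and> (\<forall>w. norm (act (B i) w) = norm w)"
      if "exp_minimal [t *\<^sub>R B i, r *\<^sub>R B j]" "t > 0" "r > 0" "i \<in> ?I" "j \<in> ?I" for i j t r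
      using exp_minimal_eigenvector_or_isometry[OF that(1) B[OF that(4)] B[OF that(5)] that(2,3) u(1)]
        Bu[OF that(4)] Bu[OF that(5)] v False by auto
    have "sorted_wrt (\<lambda>x y. exp_minimal [x, y]) ?xs"
      using exp_minimal_pairs[OF exp_minimal_commute min] .
    moreover have "[1..<k+1] = 1 # [2..<k+1]" using k by (simp add: upt_conv_Cons numeral_2_eq_2 del: upt_Suc)
    ultimately have "exp_minimal [s 1 *\<^sub>R B 1, s j *\<^sub>R B j]" if "j \<in> {2..k}" for j
      using that by (auto simp del: upt_Suc)
    then have "B 1 = B j" if "j \<in> {2..k}" for j
      using pair[of "s 1" 1 "s j" j] s that by auto
    moreover have "exp_minimal [s 1 *\<^sub>R B 1]"
      using exp_minimal_infix[of "[]" "[s 1 *\<^sub>R B 1]" "map (\<lambda>i. s i *\<^sub>R B i) [2..<k+1]"] min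
        \<open>[1..<k+1] = 1 # [2..<k+1]\<close> by simp
    \<comment> \<open>Halving the first factor yields a minimal pair even for \<open>k = 1\<close>,
      which gives the isometry.\<close>
    then have "exp_minimal [(s 1 / 2) *\<^sub>R B 1, (s 1 / 2) *\<^sub>R B 1]"
      using exp_minimal_split[of "[]" "s 1" "B 1" "[]" "s 1 / 2" "s 1 / 2"] s[of 1] k by simp
    then have "\<forall>w. norm (act (B 1) w) = norm w"
      using pair[of "s 1 / 2" 1 "s 1 / 2" 1] s[of 1] k by simp
    moreover have "j = 1 \<or> j \<in> {2..k}" if "j \<in> ?I" for j using that by auto
    ultimately show ?thesis by metis
  qed
qed

section \<open>Real and complex normal forms\<close>

lemma conjg_real [simp]: "conjg x = x" for x :: real
  by (simp add: conjg_def power2_eq_square)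

lemma conjg_complex [simp]: "conjg z = cnj z"
proof (cases "z = 0")
  case False
  then show ?thesis unfolding conjg_def complex_norm_square by simp
qed (simp add: conjg_def)

lemma orthogonal_matrix_frame:
  fixes u :: "real^2"
  assumes "norm u = 1"
  shows "orthogonal_matrix (frame u)"
proof -
  have "transpose (frame u) = coframe u"
    by (simp add: vec_eq_iff forall_2 transpose_def frame_def coframe_def)
  then show ?thesis using frame_coframe[OF assms] by (simp add: orthogonal_matrix_def)
qed

lemma unitary_matrix_frame:
  fixes u :: "complex^2"
  assumes "norm u = 1"
  shows "unitary_matrix (frame u)"
proof -
  have "cnj_transpose (frame u) = coframe u"
    by (simp add: vec_eq_iff forall_2 cnj_transpose_def frame_def coframe_def)
  then show ?thesis using frame_coframe[OF assms] by (simp add: unitary_matrix_def)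
qed

lemma complex_eigenvector_2:
  fixes A :: "complex^2^2"
  obtains x c where "x \<noteq> 0" "A *v x = c *s x"
proof (cases "A $ 1 $ 2 = 0")
  case True
  then show thesis
    by (intro that[of "axis 2 1" "A $ 2 $ 2"])
      (auto simp: vec_eq_iff forall_2 matrix_vector_mult_def sum_2 axis_def)
next
  case False
  let ?p = "A $ 1 $ 1" and ?q = "A $ 1 $ 2" and ?r = "A $ 2 $ 1" and ?s = "A $ 2 $ 2"
  \<comment> \<open>A root of the characteristic polynomial. The vector \<open>x\<close> below
    solves the first row of the eigenvector equation for any \<open>c\<close>; the second row is
    \<open>char\<close>.\<close>
  define c where "c = (?p + ?s + csqrt ((?p - ?s)\<^sup>2 + 4 * ?q * ?r)) / 2"
  have "2 * c - (?p + ?s) = csqrt ((?p - ?s)\<^sup>2 + 4 * ?q * ?r)"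
    by (simp add: c_def field_simps)
  then have "(2 * c - (?p + ?s))\<^sup>2 = (?p - ?s)\<^sup>2 + 4 * ?q * ?r"
    by simp
  then have "4 * ((c - ?p) * (c - ?s)) = 4 * (?q * ?r)"
    by (simp add: power2_eq_square algebra_simps)
  then have char: "(c - ?p) * (c - ?s) = ?q * ?r" by (simp del: mult_eq_0_iff)
  define x where "x = (\<chi> i. if i = 1 then ?q else c - ?p :: complex^2)"
  show thesis
  proof (rule that)
    show "x \<noteq> 0" using False by (auto simp: x_def vec_eq_iff forall_2)
    show "A *v x = c *s x"
      using char by (simp add: vec_eq_iff forall_2 matrix_vector_mult_def sum_2 x_def algebra_simps)
  qed
qed

lemma diag_family_in_frame:
  fixes B :: "nat \<Rightarrow> ('a::{real_normed_field,euclidean_space}, 2) sqmat"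
  assumes "norm u = 1" "norm \<theta> = 1"
    and "\<And>i. i \<in> I \<Longrightarrow> norm (B i) = 1" "\<And>i. i \<in> I \<Longrightarrow> act (B i) u = \<theta> *s u"
  shows "\<exists>l. \<forall>i\<in>I. frame u ** of_sqmat (B i) ** matrix_inv (frame u) = diag2 \<theta> (l i)"
proof -
  have "\<exists>l. frame u ** of_sqmat (B i) ** matrix_inv (frame u) = diag2 \<theta> l" if i: "i \<in> I" for i
  proof -
    have "norm (B i) \<le> 1" using assms(3)[OF i] by simp
    then obtain l where "frame u ** of_sqmat (B i) ** coframe u = diag2 \<theta> l"
      by (rule diag_in_frame[OF _ assms(1,2) assms(4)[OF i]])
    then show ?thesis using matrix_inv_frame[OF assms(1)] by auto
  qed
  then show ?thesis by metis
qed

lemma magnus_minimal_cases: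
  fixes B :: "nat \<Rightarrow> 'a::{real_normed_field,euclidean_space}^2^2"
  assumes k: "k \<ge> 1" and s: "\<forall>i\<in>{1..k}. s i > 0" and B: "\<forall>i\<in>{1..k}. opnorm (B i) = 1"
    and magnus: "magnus (prodexp (map (\<lambda>i. s i *\<^sub>R B i) [1..<k+1])) = (\<Sum>i=1..k. s i)"
  shows "(\<exists>u \<theta>. norm u = 1 \<and> norm \<theta> = 1 \<and> (\<forall>i\<in>{1..k}. act (to_sqmat (B i)) u = \<theta> *s u)) \<or>
    ((\<forall>i\<in>{1..k}. B i = B 1) \<and> (\<forall>w. norm (B 1 *v w) = norm w))"
proof -
  define A where "A i = to_sqmat (B i)" for i
  have BA: "B i = of_sqmat (A i)" for i by (simp add: A_def)
  let ?xs = "map (\<lambda>i. s i *\<^sub>R A i) [1..<k+1]"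
  have nA: "norm (A i) = 1" if "i \<in> {1..k}" for i
    using B that by (simp add: norm_sqmat.rep_eq BA)
  have set: "set [1..<k+1] = {1..k}" by auto
  have eq: "map of_sqmat ?xs = map (\<lambda>i. s i *\<^sub>R B i) [1..<k+1]"
    by (simp add: BA scaleR_sqmat.rep_eq del: upt_Suc)
  have "sum_list (map norm ?xs) = (\<Sum>i=1..k. s i)"
    unfolding map_map interv_sum_list_conv_sum_set_nat set using s nA by (intro sum.cong) (auto intro!: abs_of_pos)
  then have "exp_minimal ?xs"
    using magnus k by (intro exp_minimal_of_magnus) (simp_all only: eq, simp)
  from exp_minimal_common_eigenvector_or_isometry[OF k _ nA this]
  have "(\<exists>u \<theta>. norm u = 1 \<and> norm \<theta> = 1 \<and> (\<forall>i\<in>{1..k}. act (A i) u = \<theta> *s u)) \<or>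
    ((\<forall>i\<in>{1..k}. A i = A 1) \<and> (\<forall>w. norm (act (A 1) w) = norm w))"
    using s by blast
  then show ?thesis by (auto simp: A_def[symmetric] BA act.rep_eq)
qed

theorem theorem5p5:
  fixes k :: nat and s :: "nat \<Rightarrow> real"
    and B :: "nat \<Rightarrow> real^2^2" and Bc :: "nat \<Rightarrow> complex^2^2"
  assumes "k \<ge> 1" and "\<forall>i\<in>{1..k}. s i > 0"
  shows "((\<forall>i\<in>{1..k}. opnorm (B i) = 1) \<and>
          magnus (prodexp (map (\<lambda>i. s i *\<^sub>R B i) [1..<k+1])) = (\<Sum>i=1..k. s i)
          \<longrightarrow>
          (\<exists>U eps lam. orthogonal_matrix U \<and> eps \<in> {1, -1} \<and>
              (\<forall>i\<in>{1..k}. U ** B i ** matrix_inv U = diag2 eps (lam i)))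
          \<or> (\<exists>U0. orthogonal_matrix U0 \<and> (\<forall>i\<in>{1..k}. B i = U0)))
       \<and>
         ((\<forall>i\<in>{1..k}. opnorm (Bc i) = 1) \<and>
          magnus (prodexp (map (\<lambda>i. s i *\<^sub>R Bc i) [1..<k+1])) = (\<Sum>i=1..k. s i)
          \<longrightarrow>
          (\<exists>V u lam. unitary_matrix V \<and> norm u = 1 \<and>
              (\<forall>i\<in>{1..k}. V ** Bc i ** matrix_inv V = diag2 u (lam i))))"
proof (intro conjI impI; elim conjE)
  assume B: "\<forall>i\<in>{1..k}. opnorm (B i) = 1"
    and magnus: "magnus (prodexp (map (\<lambda>i. s i *\<^sub>R B i) [1..<k+1])) = (\<Sum>i=1..k. s i)"
  show "(\<exists>U eps lam. orthogonal_matrix U \<and> eps \<in> {1, -1} \<and>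
              (\<forall>i\<in>{1..k}. U ** B i ** matrix_inv U = diag2 eps (lam i)))
          \<or> (\<exists>U0. orthogonal_matrix U0 \<and> (\<forall>i\<in>{1..k}. B i = U0))"
    using magnus_minimal_cases[OF assms B magnus]
  proof (elim disjE exE conjE)
    fix u :: "real^2" and \<theta> :: real
    assume u: "norm u = 1" "norm \<theta> = 1" "\<forall>i\<in>{1..k}. act (to_sqmat (B i)) u = \<theta> *s u"
    obtain l where "\<forall>i\<in>{1..k}. frame u ** B i ** matrix_inv (frame u) = diag2 \<theta> (l i)"
      using diag_family_in_frame[OF u(1,2), of "{1..k}" "\<lambda>i. to_sqmat (B i)"] u(3) B
      by (auto simp: norm_sqmat.rep_eq)
    moreover have "\<theta> \<in> {1, -1}" using u(2) by auto
    ultimately show ?thesis using orthogonal_matrix_frame[OF u(1)] by blast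
  next
    assume "\<forall>i\<in>{1..k}. B i = B 1" and iso: "\<forall>w. norm (B 1 *v w) = norm w"
    moreover have "orthogonal_transformation ((*v) (B 1))"
      using iso by (simp add: orthogonal_transformation)
    then have "orthogonal_matrix (B 1)"
      by (simp add: orthogonal_transformation_matrix)
    ultimately show ?thesis by blast
  qed
next
  assume B: "\<forall>i\<in>{1..k}. opnorm (Bc i) = 1"
    and magnus: "magnus (prodexp (map (\<lambda>i. s i *\<^sub>R Bc i) [1..<k+1])) = (\<Sum>i=1..k. s i)"
  have "\<exists>u \<theta>. norm u = 1 \<and> norm \<theta> = 1 \<and> (\<forall>i\<in>{1..k}. act (to_sqmat (Bc i)) u = \<theta> *s u)"
    using magnus_minimal_cases[OF assms B magnus]
  proof (elim disjE conjE)
    assume eq: "\<forall>i\<in>{1..k}. Bc i = Bc 1" and iso: "\<forall>w. norm (Bc 1 *v w) = norm w"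
    \<comment> \<open>A complex isometry has an eigenvector, with eigenvalue of modulus one, so this
      case leads to the same conclusion as the other.\<close>
    obtain x c where x: "x \<noteq> 0" "Bc 1 *v x = c *s x" by (rule complex_eigenvector_2)
    define u where "u = of_real (1 / norm x) *s x"
    have "Bc 1 *v u = c *s u"
      unfolding u_def vector_scalar_commute x(2) by (simp add: vec_eq_iff)
    moreover have u: "norm u = 1" using x(1) by (simp add: u_def norm_vector_scalar norm_divide)
    moreover have "norm c = 1"
      using iso[rule_format, of u] u \<open>Bc 1 *v u = c *s u\<close> by (simp add: norm_vector_scalar)
    moreover have "act (to_sqmat (Bc i)) u = c *s u" if "i \<in> {1..k}" for i
      unfolding act.rep_eq of_to_sqmat bspec[OF eq that] by fact
    ultimately show ?thesis by blast
  qed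
  then obtain u \<theta> where u: "norm u = 1" "norm \<theta> = 1"
    "\<forall>i\<in>{1..k}. act (to_sqmat (Bc i)) u = \<theta> *s u" by blast
  obtain l where "\<forall>i\<in>{1..k}. frame u ** Bc i ** matrix_inv (frame u) = diag2 \<theta> (l i)"
    using diag_family_in_frame[OF u(1,2), of "{1..k}" "\<lambda>i. to_sqmat (Bc i)"] u(3) B
    by (auto simp: norm_sqmat.rep_eq)
  then show "\<exists>V u lam. unitary_matrix V \<and> norm u = 1 \<and>
      (\<forall>i\<in>{1..k}. V ** Bc i ** matrix_inv V = diag2 u (lam i))"
    using unitary_matrix_frame[OF u(1)] u(2) by blast
qed

end
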